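(* Let $\alpha\in(0,1)$, $\theta>0$, $\lambda_1,\lambda_2>0$. The discrete Lévy measure $\mathcal V_{\alpha,\theta}$ of the bivariate tempered space-fractional Poisson process $\{\mathcal Q^{\alpha,\theta}(t)\}_{t\ge0}$ with these parameters is given by $$\mathcal V_{\alpha,\theta}(\cdot)=\sum_{k_1,k_2>0}\frac{\lambda_1^{k_1}\lambda_2^{k_2}}{k_1!\,k_2!}\,\frac{\alpha\,\Gamma(k_1+k_2-\alpha)}{\Gamma(1-\alpha)}\,\delta_{\{\mathbf k\}}(\cdot)\,(\theta+k_1+k_2)^{\alpha-k_1-k_2},$$ where $\mathbf k=(k_1,k_2)$ and $\delta_{\{\mathbf k\}}$ is the Dirac measure concentrated at $\mathbf k$.
   Context: The tempered $\alpha$-stable subordinator $\{S^{\alpha,\theta}(t)\}_{t\ge0}$ is the Lévy subordinator with $\mathbb E[e^{-uS^{\alpha,\theta}(t)}]=e^{-t((u+\theta)^\alpha-\theta^\alpha)}$, $u\ge0$; its Lévy measure has density $\nu(s)=\frac{\alpha}{\Gamma(1-\alpha)}\frac{e^{-\theta s}}{s^{\alpha+1}}$, $s>0$. Let $\{\mathcal N_i(t,\lambda_i)\}_{t\ge0}$, $i=1,2$, be independent homogeneous Poisson processes with rates $\lambda_i$, independent of $S^{\alpha,\theta}$. The bivariate tempered space-fractional Poisson process is $\mathcal Q^{\alpha,\theta}(t)=(\mathcal N_1(S^{\alpha,\theta}(t),\lambda_1),\mathcal N_2(S^{\alpha,\theta}(t),\lambda_2))$. In the sum $k_1,k_2$ are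 integers.
   Formalization: The printed formula is false for all parameters; the base θ+k1+k2 of the power is corrected to θ+λ1+λ2, and the sum over k1,k2>0 is corrected to all nonnegative integers (k1,k2) ≠ (0,0), so that the atoms on the axes are included. *)

theory Defs
  imports "HOL-Probability.Probability"
begin

(* Path properties are required for every sample point, not only almost surely: otherwise the
   subordinated process N (S t) is in general measurable only with respect to the completion
   of M. Stochastic continuity is implied by right continuity and stationary increments. *)
definition levy_process :: "'a measure \<Rightarrow> (real \<Rightarrow> 'a \<Rightarrow> 'b::euclidean_space) \<Rightarrow> bool" where
  "levy_process M X \<longleftrightarrow>
     prob_space M \<and>
     (\<forall>t\<ge>0. X t \<in> borel_measurable M) \<and>
     (\<forall>\<omega>\<in>space M. X 0 \<omega> = 0) \<and>
     (\<forall>(\<tau>::nat \<Rightarrow> real) n. 0 \<le> \<tau> 0 \<longrightarrow> (\<forall>i<n. \<tau> i \<le> \<tau> (Suc i)) \<longrightarrow>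
        prob_space.indep_vars M (\<lambda>_. borel) (\<lambda>i \<omega>. X (\<tau> (Suc i)) \<omega> - X (\<tau> i) \<omega>) {..<n}) \<and>
     (\<forall>s\<ge>0. \<forall>h\<ge>0. distr M borel (\<lambda>\<omega>. X (s + h) \<omega> - X s \<omega>) = distr M borel (X h)) \<and>
     (\<forall>\<omega>\<in>space M. \<forall>t\<ge>0. ((\<lambda>s. X s \<omega>) \<longlongrightarrow> X t \<omega>) (at_right t)) \<and>
     (\<forall>\<omega>\<in>space M. \<forall>t>0. \<exists>l. ((\<lambda>s. X s \<omega>) \<longlongrightarrow> l) (at_left t))"

definition subordinator :: "'a measure \<Rightarrow> (real \<Rightarrow> 'a \<Rightarrow> real) \<Rightarrow> bool" where
  "subordinator M S \<longleftrightarrow>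
     levy_process M S \<and> (\<forall>\<omega>\<in>space M. \<forall>s t. 0 \<le> s \<longrightarrow> s \<le> t \<longrightarrow> S s \<omega> \<le> S t \<omega>)"

definition tempered_stable_subordinator ::
    "'a measure \<Rightarrow> real \<Rightarrow> real \<Rightarrow> (real \<Rightarrow> 'a \<Rightarrow> real) \<Rightarrow> bool" where
  "tempered_stable_subordinator M \<alpha> \<theta> S \<longleftrightarrow>
     subordinator M S \<and>
     (\<forall>t\<ge>0. \<forall>u\<ge>0. (LINT \<omega>|M. exp (- u * S t \<omega>)) =
        exp (- t * ((u + \<theta>) powr \<alpha> - \<theta> powr \<alpha>)))"

(* poisson_pmf is unspecified at rate 0, hence t > 0. *)
definition poisson_process :: "'a measure \<Rightarrow> real \<Rightarrow> (real \<Rightarrow> 'a \<Rightarrow> nat) \<Rightarrow> bool" where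
  "poisson_process M r N \<longleftrightarrow>
     levy_process M (\<lambda>t \<omega>. real (N t \<omega>)) \<and>
     (\<forall>t>0. distr M (count_space UNIV) (N t) = measure_pmf (poisson_pmf (r * t)))"

definition independent_processes ::
    "'a measure \<Rightarrow> ('i \<Rightarrow> real \<Rightarrow> 'a \<Rightarrow> real) \<Rightarrow> 'i set \<Rightarrow> bool" where
  "independent_processes M X I \<longleftrightarrow>
     prob_space.indep_vars M (\<lambda>_. PiM {0..} (\<lambda>_. borel)) (\<lambda>i \<omega>. \<lambda>t\<in>{0..}. X i t \<omega>) I"

(* Levy-Khintchine representation with truncation function x * indicator of the closed unit
   ball; A is the Gaussian covariance operator and b the drift. nu is uniquely determined by X. *)
definition has_levy_measure ::
    "'a measure \<Rightarrow> (real \<Rightarrow> 'a \<Rightarrow> 'b::euclidean_space) \<Rightarrow> 'b measure \<Rightarrow> bool" where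
  "has_levy_measure M X \<nu> \<longleftrightarrow>
     levy_process M X \<and>
     sets \<nu> = sets borel \<and> emeasure \<nu> {0} = 0 \<and>
     (\<integral>\<^sup>+ x. ennreal (min 1 ((norm x)\<^sup>2)) \<partial>\<nu>) < \<infinity> \<and>
     (\<exists>(b::'b) (A::'b \<Rightarrow> 'b).
        linear A \<and> (\<forall>x y. A x \<bullet> y = x \<bullet> A y) \<and> (\<forall>x. 0 \<le> x \<bullet> A x) \<and>
        (\<forall>t\<ge>0. \<forall>u.
           (LINT \<omega>|M. iexp (u \<bullet> X t \<omega>)) =
           exp (of_real t *
             (\<i> * of_real (b \<bullet> u) - of_real (u \<bullet> A u) / 2 +
              (LINT x|\<nu>. (iexp (u \<bullet> x) - 1 - \<i> * of_real ((u \<bullet> x) * indicat_real (cball 0 1) x)))))))"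

(* State space embedded in the plane. The Levy measure of this process is the integral over s > 0
   of the law of (N1 s, N2 s) against the Levy measure of S, restricted to the complement of the
   origin. The mass at k = (k1, k2) is therefore
     lambda1^k1 lambda2^k2 / (k1! k2!) * alpha / Gamma (1 - alpha) *
       integral of s^(k1 + k2 - alpha - 1) exp (- (theta + lambda1 + lambda2) s) over s > 0,
   which contains the power (theta + lambda1 + lambda2)^(alpha - k1 - k2) and is positive also on
   the two coordinate axes. The source prints theta + k1 + k2 for the base of this power and
   k1, k2 > 0 for the range of summation; both are misprints. *)
definition bivariate_tsfpp ::
    "(real \<Rightarrow> 'a \<Rightarrow> real) \<Rightarrow> (real \<Rightarrow> 'a \<Rightarrow> nat) \<Rightarrow> (real \<Rightarrow> 'a \<Rightarrow> nat) \<Rightarrow> real \<Rightarrow> 'a \<Rightarrow> real \<times> real"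
  where
  "bivariate_tsfpp S N1 N2 t \<omega> = (real (N1 (S t \<omega>) \<omega>), real (N2 (S t \<omega>) \<omega>))"

end

(* Let phi(u) = lam1 (1 - exp(i u1)) + lam2 (1 - exp(i u2)). Conditioning on the subordinator, which
   is independent of the Poisson processes, gives E exp(i u . Q_t) = E exp(- phi(u) S_t), and the
   same conditioning shows that the increments of Q are independent and stationary. The Laplace
   transform of S_t extends analytically to the right half plane, hence the characteristic exponent
   of Q is theta^alpha - (theta + phi(u))^alpha. With c = theta + lam1 + lam2 and
   w = lam1 exp(i u1) + lam2 exp(i u2) we have theta + phi(u) = c - w, and the generalised binomial
   series of c^alpha - (c - w)^alpha in powers of w, expanded by the binomial theorem, has the
   masses of the Levy measure as its coefficients. *)

theory Submission
  imports Defs "HOL-Complex_Analysis.Complex_Analysis"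
begin

section \<open>The binomial series of the characteristic exponent\<close>

text \<open>The base point c is what makes the expansion work: norm w is at most lam1 + lam2 at
  every frequency u, and this is strictly below c because \<theta> > 0. The series therefore
  converges absolutely, may be rearranged into a double series, and has finite total mass at w =
  lam1 + lam2. So the Levy measure is finite, its truncation term can be integrated separately and
  absorbed into the drift, and the Gaussian part is 0. Analytic continuation reaches only the open
  half plane, whereas phi(u) is known only to have nonnegative real part. It meets the imaginary
  axis only at 0, where the transform is trivially 1, so no limit at the boundary is taken.
  Conditioning is carried out by Fubini on independent path spaces, which calls for joint
  measurability of path and time. One product formula for bounded test functions of the increments
  then serves twice: indicators give independence and stationarity on rectangles, exponentials give
  the characteristic function.\<close>

lemma gbinomial_Suc_real_Gamma:
  fixes a :: real
  assumes "0 < a" "a < 1"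
  shows "a * Gamma (real (Suc n) - a) / (Gamma (1 - a) * fact (Suc n)) = (-1) ^ n * (a gchoose Suc n)"
proof (induction n)
  case 0
  have "Gamma (1 - a) > 0" using assms by (intro Gamma_real_pos) simp
  then show ?case by simp
next
  case (Suc n)
  have g: "Gamma (real (Suc (Suc n)) - a) = (real (Suc n) - a) * Gamma (real (Suc n) - a)"
  proof -
    have "real (Suc n) - a > 0" using assms by simp
    then have "real (Suc n) - a \<notin> \<int>\<^sub>\<le>\<^sub>0" by (meson nonpos_Ints_nonpos not_le)
    from Gamma_plus1[OF this] show ?thesis by (simp add: algebra_simps)
  qed
  \<comment> \<open>Passing from n to n + 1 multiplies both sides by (n + 1 - a) / (n + 2); on the
    right the sign is absorbed by the power of -1.\<close>
  have b: "(a gchoose Suc (Suc n)) = (a - real (Suc n)) / real (Suc (Suc n)) * (a gchoose Suc n)"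
    using gbinomial_absorb_comp[of a "Suc n"] gbinomial_absorption'[of "Suc (Suc n)" a]
    by (simp add: gbinomial_prod_rev prod.atLeast0_lessThan_Suc field_simps)
  have "a * Gamma (real (Suc (Suc n)) - a) / (Gamma (1 - a) * fact (Suc (Suc n)))
    = (real (Suc n) - a) / real (Suc (Suc n)) * (a * Gamma (real (Suc n) - a) / (Gamma (1 - a) * fact (Suc n)))"
    unfolding g fact_Suc[of "Suc n"] by (simp add: mult_ac)
  also have "\<dots> = (-1) ^ Suc n * (a gchoose Suc (Suc n))"
    unfolding Suc.IH b by (simp add: field_simps)
  finally show ?case .
qed

text \<open>For n > 0 and 0 < a < 1 this is (-1)^(n - 1) times the n-th derivative of u powr a at c,
  or equally the integral of s^n exp (- c s) against the stable Levy density. At n = 0 it would be -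
  c powr a, so the series below start at \<open>Suc n\<close>.\<close>

definition levy_coeff :: "real \<Rightarrow> real \<Rightarrow> nat \<Rightarrow> real" where
  "levy_coeff a c n = a * Gamma (real n - a) / Gamma (1 - a) * c powr (a - real n)"

lemma levy_coeff_nonneg:
  assumes "0 < a" "a < 1" "n > 0"
  shows "levy_coeff a c n \<ge> 0"
proof -
  have "real n - a > 0" "1 - a > 0" using assms by linarith+
  from this[THEN Gamma_real_pos] show ?thesis unfolding levy_coeff_def using assms by simp
qed

text \<open>A positive real factor leaves the argument of z alone, so the principal branch
  contributes no extra factor.\<close>

lemma powr_mult_of_real_pos:
  fixes z :: complex
  assumes "c > 0" "z \<noteq> 0"
  shows "(of_real c * z) powr a = of_real c powr a * z powr a"
  using assms by (simp add: powr_def Ln_times_of_real Ln_of_real distrib_left exp_add)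

text \<open>Binomial series of (1 - w / c) powr a, scaled by c powr a, with its constant term moved
  to the other side. The signs of the binomial coefficients cancel those of the powers of
  -w.\<close>

lemma levy_coeff_sums:
  fixes w :: complex
  assumes a: "0 < a" "a < 1" and w: "norm w < c"
  shows "(\<lambda>n. of_real (levy_coeff a c (Suc n) / fact (Suc n)) * w ^ Suc n) sums
     (of_real (c powr a) - (of_real c - w) powr of_real a)"
proof -
  have c: "c > 0" using w norm_ge_zero[of w] by linarith
  have "norm (- w / of_real c) < 1" using w c by (simp add: norm_divide)
  from gen_binomial_complex[OF this, of "of_real a"]
  have "(\<lambda>n. (of_real a gchoose Suc n) * (- w / of_real c) ^ Suc n) sums ((1 + - w / of_real c) powr of_real a - 1)"
    by (subst sums_Suc_iff) simp
  then have "(\<lambda>n. - of_real (c powr a) * ((of_real a gchoose Suc n) * (- w / of_real c) ^ Suc n)) sums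
     (- of_real (c powr a) * ((1 + - w / of_real c) powr of_real a - 1))"
    by (rule sums_mult)
  also have "- of_real (c powr a) * ((1 + - w / of_real c) powr of_real a - 1) =
     of_real (c powr a) - (of_real c - w) powr of_real a"
  proof -
    have "1 + - w / of_real c \<noteq> 0" using w c by (auto simp: field_simps)
    from powr_mult_of_real_pos[OF c this, of "of_real a"]
    have "(of_real c - w) powr of_real a = of_real (c powr a) * (1 + - w / of_real c) powr of_real a"
      using c by (simp add: right_diff_distrib powr_of_real)
    then show ?thesis by (simp add: algebra_simps)
  qed
  also have "(\<lambda>n. - of_real (c powr a) * ((of_real a gchoose Suc n) * (- w / of_real c) ^ Suc n)) =
     (\<lambda>n. of_real (levy_coeff a c (Suc n) / fact (Suc n)) * w ^ Suc n)"
  proof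
    fix n
    have e: "levy_coeff a c (Suc n) / fact (Suc n) = (-1) ^ n * (a gchoose Suc n) * (c powr a / c ^ Suc n)"
    proof -
      have "levy_coeff a c (Suc n) / fact (Suc n) =
         (a * Gamma (real (Suc n) - a) / (Gamma (1 - a) * fact (Suc n))) * c powr (a - real (Suc n))"
        by (simp add: levy_coeff_def)
      also have "c powr (a - real (Suc n)) = c powr a / c ^ Suc n"
        using c by (simp only: powr_diff powr_realpow)
      finally show ?thesis unfolding gbinomial_Suc_real_Gamma[OF a] .
    qed
    have g: "complex_of_real (a gchoose Suc n) = of_real a gchoose Suc n"
      by (simp add: gbinomial_prod_rev)
    have p: "(- w / of_real c) ^ Suc n = (-1) ^ Suc n * w ^ Suc n / of_real c ^ Suc n"
      unfolding power_divide power_minus[of w] ..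
    show "- of_real (c powr a) * ((of_real a gchoose Suc n) * (- w / of_real c) ^ Suc n) =
       of_real (levy_coeff a c (Suc n) / fact (Suc n)) * w ^ Suc n"
      unfolding e p of_real_mult of_real_divide of_real_power g
      using c by (simp add: field_simps)
  qed
  finally show ?thesis .
qed

definition levy_mass :: "real \<Rightarrow> real \<Rightarrow> real \<Rightarrow> real \<Rightarrow> nat \<times> nat \<Rightarrow> real" where
  "levy_mass a c l1 l2 = (\<lambda>(k1, k2). l1 ^ k1 * l2 ^ k2 / (fact k1 * fact k2) * levy_coeff a c (k1 + k2))"

lemma binomial_antidiagonal:
  fixes x y :: "'a::field_char_0"
  shows "(\<Sum>(j,k) | j + k = n. x ^ j * y ^ k / (fact j * fact k)) = (x + y) ^ n / fact n"
proof -
  have "(\<Sum>(j,k) | j + k = n. x ^ j * y ^ k / (fact j * fact k)) = (\<Sum>j\<le>n. x ^ j * y ^ (n - j) / (fact j * fact (n - j)))"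
    by (rule sum.reindex_bij_witness[of _ "\<lambda>j. (j, n - j)" fst]) auto
  also have "\<dots> = (\<Sum>j\<le>n. of_nat (n choose j) * x ^ j * y ^ (n - j)) / fact n"
    unfolding sum_divide_distrib by (rule sum.cong) (auto simp: binomial_fact field_simps)
  finally show ?thesis by (simp add: binomial_ring)
qed

lemma finite_antidiagonal: "finite {(j,k). j + k = (n::nat)}"
  by (rule finite_subset[of _ "{..n} \<times> {..n}"]) auto

text \<open>\<open>levy_coeff\<close> sees a pair only through j + k, so on an antidiagonal the
  binomial theorem collapses the masses to a single power.\<close>

lemma levy_mass_antidiagonal:
  fixes x y :: "'a::real_normed_field"
  shows "(\<Sum>(j,k) | j + k = n. of_real (levy_mass a c l1 l2 (j, k)) * (x ^ j * y ^ k)) =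
    of_real (levy_coeff a c n / fact n) * (of_real l1 * x + of_real l2 * y) ^ n"
proof -
  have "(\<Sum>(j,k) | j + k = n. of_real (levy_mass a c l1 l2 (j, k)) * (x ^ j * y ^ k)) =
    of_real (levy_coeff a c n) * (\<Sum>(j,k) | j + k = n. (of_real l1 * x) ^ j * (of_real l2 * y) ^ k / (fact j * fact k))"
    unfolding sum_distrib_left by (rule sum.cong) (auto simp: levy_mass_def power_mult_distrib)
  then show ?thesis unfolding binomial_antidiagonal by simp
qed

lemma antidiagonal_bij:
  "bij_betw snd (Sigma {1..} (\<lambda>n. {(j,k). j + k = n})) {k :: nat \<times> nat. k \<noteq> (0, 0)}"
  by (rule bij_betwI[where g = "\<lambda>(j,k). (j + k, (j, k))"]) (auto simp: Suc_le_eq)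

lemma levy_mass_nonneg:
  assumes "0 < a" "a < 1" "0 \<le> l1" "0 \<le> l2" "k \<noteq> (0, 0)"
  shows "levy_mass a c l1 l2 k \<ge> 0"
proof (cases k)
  case (Pair i j)
  then show ?thesis
    using assms levy_coeff_nonneg[OF assms(1,2), of "i + j" c] by (simp add: levy_mass_def)
qed

text \<open>Regroups the power series in w by antidiagonals. Summability is settled at x = y = 1,
  where the terms are the masses themselves, hence nonnegative, and w = l1 + l2 < c. These dominate
  the terms for all x and y in the closed unit disc.\<close>

lemma levy_mass_has_sum:
  fixes x y :: complex
  assumes a: "0 < a" "a < 1" and l: "0 < l1" "0 < l2" and c: "l1 + l2 < c"
    and x: "norm x \<le> 1" and y: "norm y \<le> 1"
  shows "((\<lambda>(j,k). of_real (levy_mass a c l1 l2 (j, k)) * (x ^ j * y ^ k)) has_sum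
     (of_real (c powr a) - (of_real c - (of_real l1 * x + of_real l2 * y)) powr of_real a)) {k. k \<noteq> (0, 0)}" (is "(?f has_sum _) _")
    and "levy_mass a c l1 l2 summable_on {k. k \<noteq> (0, 0)}"
proof -
  let ?D = "\<lambda>n::nat. {(j,k::nat). j + k = n}"
  let ?w = "of_real l1 * x + of_real l2 * y"
  have bnd: "norm ?w < c"
  proof -
    have "norm (of_real l1 * x) \<le> l1" "norm (of_real l2 * y) \<le> l2"
      using x y l by (simp_all add: norm_mult mult_left_le)
    then show ?thesis using norm_triangle_ineq[of "of_real l1 * x" "of_real l2 * y"] c by linarith
  qed
  have img: "Suc ` UNIV = {1..}" by (auto simp: image_iff Suc_le_eq dest: gr0_implies_Suc)
  have summ: "(\<lambda>n. levy_coeff a c n / fact n * (l1 + l2) ^ n) summable_on {1..}"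
  proof -
    have "norm (of_real (l1 + l2) :: complex) < c" using l c by (simp flip: of_real_add)
    from levy_coeff_sums[OF a this]
    have "summable (\<lambda>n. complex_of_real (levy_coeff a c (Suc n) / fact (Suc n) * (l1 + l2) ^ Suc n))"
      by (simp add: sums_iff)
    then have "summable (\<lambda>n. levy_coeff a c (Suc n) / fact (Suc n) * (l1 + l2) ^ Suc n)"
      by (simp only: summable_complex_of_real)
    then have "(\<lambda>n. levy_coeff a c (Suc n) / fact (Suc n) * (l1 + l2) ^ Suc n) summable_on UNIV"
      using l by (intro summable_nonneg_imp_summable_on) (auto intro!: mult_nonneg_nonneg divide_nonneg_nonneg levy_coeff_nonneg a)
    then show ?thesis
      unfolding img[symmetric] by (subst summable_on_reindex) (auto simp: o_def)
  qed
  have mass: "(\<lambda>(n, k). levy_mass a c l1 l2 k) summable_on Sigma {1..} ?D"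
  proof (rule summable_on_SigmaI[OF _ summ])
    fix n :: nat assume "n \<in> {1..}"
    show "((\<lambda>k. case (n, k) of (n, k) \<Rightarrow> levy_mass a c l1 l2 k) has_sum levy_coeff a c n / fact n * (l1 + l2) ^ n) (?D n)"
      using levy_mass_antidiagonal[where n = n and a = a and c = c and ?l1.0 = l1 and ?l2.0 = l2 and x = "1::real" and y = 1] finite_antidiagonal[of n]
      by (intro has_sum_finiteI) (auto simp: split_def)
  qed (use a l in \<open>auto intro!: levy_mass_nonneg\<close>)
  then show s: "levy_mass a c l1 l2 summable_on {k. k \<noteq> (0, 0)}"
    using summable_on_reindex_bij_betw[OF antidiagonal_bij, of "levy_mass a c l1 l2"] by (simp add: split_def)
  have fs: "?f summable_on {k. k \<noteq> (0, 0)}"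
  proof (rule abs_summable_summable, rule summable_on_comparison_test[OF s])
    fix k :: "nat \<times> nat" assume "k \<in> {k. k \<noteq> (0, 0)}"
    moreover obtain i j where "k = (i, j)" by (cases k)
    ultimately show "norm (?f k) \<le> levy_mass a c l1 l2 k"
      using levy_mass_nonneg[OF a, of l1 l2 "(i,j)" c] l x y
      by (auto simp: norm_mult norm_power intro!: mult_left_le mult_le_one power_le_one)
  qed auto
  have "((\<lambda>(n, k). ?f k) has_sum (of_real (c powr a) - (of_real c - ?w) powr of_real a)) (Sigma {1..} ?D)"
  proof (rule has_sum_SigmaI)
    fix n :: nat assume "n \<in> {1..}"
    show "((\<lambda>k. case (n, k) of (n, k) \<Rightarrow> ?f k) has_sum (of_real (levy_coeff a c n / fact n) * ?w ^ n)) (?D n)"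
      using levy_mass_antidiagonal[where n = n and a = a and c = c and ?l1.0 = l1 and ?l2.0 = l2 and x = x and y = y] finite_antidiagonal[of n]
      by (intro has_sum_finiteI) (auto simp: split_def)
  next
    \<comment> \<open>\<open>has_sum\<close> is unordered, so the ordered series must be shown to
      converge absolutely; this is the same series taken at \<open>norm ?w\<close>.\<close>
    have "summable (\<lambda>n. norm (of_real (levy_coeff a c (Suc n) / fact (Suc n)) * ?w ^ Suc n))"
    proof -
      have "norm (of_real (norm ?w) :: complex) < c" using bnd by simp
      from levy_coeff_sums[OF a this]
      have "summable (\<lambda>n. complex_of_real (levy_coeff a c (Suc n) / fact (Suc n) * norm ?w ^ Suc n))"
        by (simp add: sums_iff)
      then have "summable (\<lambda>n. levy_coeff a c (Suc n) / fact (Suc n) * norm ?w ^ Suc n)"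
        by (simp only: summable_complex_of_real)
      moreover have "norm (of_real (levy_coeff a c (Suc n) / fact (Suc n)) * ?w ^ Suc n) = levy_coeff a c (Suc n) / fact (Suc n) * norm ?w ^ Suc n" for n
        using levy_coeff_nonneg[OF a, of "Suc n" c] by (simp add: norm_mult norm_power norm_divide del: power_Suc fact_Suc)
      ultimately show ?thesis by simp
    qed
    then have "((\<lambda>n. of_real (levy_coeff a c (Suc n) / fact (Suc n)) * ?w ^ Suc n) has_sum (of_real (c powr a) - (of_real c - ?w) powr of_real a)) UNIV"
      using levy_coeff_sums[OF a bnd] by (intro norm_summable_imp_has_sum)
    then show "((\<lambda>n. of_real (levy_coeff a c n / fact n) * ?w ^ n) has_sum (of_real (c powr a) - (of_real c - ?w) powr of_real a)) {1..}"
      unfolding img[symmetric] by (subst has_sum_reindex) (auto simp: o_def)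
  next
    show "(\<lambda>(n, k). ?f k) summable_on (Sigma {1..} ?D)"
      using fs summable_on_reindex_bij_betw[OF antidiagonal_bij, of ?f] by (simp add: split_def)
  qed
  then show "(?f has_sum (of_real (c powr a) - (of_real c - ?w) powr of_real a)) {k. k \<noteq> (0, 0)}"
    using has_sum_reindex_bij_betw[OF antidiagonal_bij, of ?f] by (simp add: split_def)
qed

section \<open>Analytic continuation of Laplace transforms\<close>

text \<open>Expands exp (- z X) about R, as exp (- R X) times the series of exp (- (z - R) X). The
  absolute values of the terms add up to exp (- (R - norm (z - R)) X), which is at most 1 as X is
  nonnegative; this bound lets sum and integral be exchanged.\<close>

lemma (in prob_space) laplace_power_series:
  fixes X :: "'a \<Rightarrow> real" and z :: complex
  assumes [measurable]: "X \<in> borel_measurable M" and X: "\<And>\<omega>. \<omega> \<in> space M \<Longrightarrow> 0 \<le> X \<omega>"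
    and R: "R > 0" and z: "norm (z - of_real R) < R"
  shows "(\<lambda>n. (LINT \<omega>|M. of_real (exp (- R * X \<omega>)) * (of_real (- X \<omega>) ^ n / fact n)) * (z - of_real R) ^ n)
     sums (LINT \<omega>|M. exp (- z * of_real (X \<omega>)))"
proof -
  let ?r = "norm (z - of_real R)"
  define f where "f n \<omega> = complex_of_real (exp (- R * X \<omega>)) * (of_real (- X \<omega>) ^ n / fact n) * (z - of_real R) ^ n" for n \<omega>
  define g where "g n \<omega> = exp (- R * X \<omega>) * ((X \<omega> * ?r) ^ n / fact n)" for n \<omega>
  have [measurable]: "f n \<in> borel_measurable M" "g n \<in> borel_measurable M" for n
    unfolding f_def g_def by measurable
  have nf: "norm (f n \<omega>) = g n \<omega>" if "\<omega> \<in> space M" for n \<omega>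
    using X[OF that] by (simp add: f_def g_def norm_mult norm_power norm_divide power_mult_distrib)
  have g0: "g n \<omega> \<ge> 0" if "\<omega> \<in> space M" for n \<omega>
    using X[OF that] by (simp add: g_def)
  have gs: "(\<lambda>n. g n \<omega>) sums (exp (- R * X \<omega>) * exp (X \<omega> * ?r))" for \<omega>
    unfolding g_def using exp_converges[of "X \<omega> * ?r"]
    by (intro sums_mult) (simp add: divide_inverse mult.commute)
  have g1: "(\<Sum>i<n. g i \<omega>) \<le> 1" if "\<omega> \<in> space M" for n \<omega>
  proof -
    have "(\<Sum>i<n. g i \<omega>) \<le> exp (- R * X \<omega>) * exp (X \<omega> * ?r)"
      using sum_le_suminf[OF sums_summable[OF gs[of \<omega>]], of "{..<n}"] g0[OF that] sums_unique[OF gs[of \<omega>]] by simp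
    also have "\<dots> = exp (X \<omega> * (?r - R))" by (simp add: exp_add[symmetric] algebra_simps)
    also have "\<dots> \<le> 1" using X[OF that] z by (simp add: mult_nonneg_nonpos)
    finally show ?thesis .
  qed
  have gi: "integrable M (g n)" for n
  proof (rule integrable_const_bound[of _ 1])
    show "AE \<omega> in M. norm (g n \<omega>) \<le> 1"
    proof (rule AE_I2)
      fix \<omega> assume w: "\<omega> \<in> space M"
      have "g n \<omega> \<le> (\<Sum>i<Suc n. g i \<omega>)" using g0[OF w] by (simp add: sum_nonneg)
      then show "norm (g n \<omega>) \<le> 1" using g1[OF w, of "Suc n"] g0[OF w, of n] by simp
    qed
  qed simp
  have fi: "integrable M (f n)" for n
    by (rule Bochner_Integration.integrable_bound[OF gi[of n]]) (use nf g0 in auto)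
  have "(\<lambda>n. integral\<^sup>L M (f n)) sums (LINT \<omega>|M. (\<Sum>n. f n \<omega>))"
  proof (rule sums_integral[OF fi])
    show "AE \<omega> in M. summable (\<lambda>n. norm (f n \<omega>))"
      using nf sums_summable[OF gs] by (intro AE_I2) simp
    have "(LINT \<omega>|M. norm (f n \<omega>)) = integral\<^sup>L M (g n)" for n
      by (rule Bochner_Integration.integral_cong) (use nf in auto)
    moreover have "summable (\<lambda>n. integral\<^sup>L M (g n))"
    proof (rule summableI_nonneg_bounded[where x = 1])
      show "0 \<le> integral\<^sup>L M (g n)" for n by (intro integral_nonneg_AE AE_I2 g0)
      show "(\<Sum>i<n. integral\<^sup>L M (g i)) \<le> 1" for n
      proof -
        have "(\<Sum>i<n. integral\<^sup>L M (g i)) = (LINT \<omega>|M. (\<Sum>i<n. g i \<omega>))"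
          by (subst Bochner_Integration.integral_sum) (use gi in auto)
        also have "\<dots> \<le> (LINT \<omega>|M. 1)"
          using gi g1 by (intro integral_mono) auto
        finally show ?thesis by (simp add: prob_space)
      qed
    qed
    ultimately show "summable (\<lambda>n. LINT \<omega>|M. norm (f n \<omega>))" by simp
  qed
  moreover have "(\<Sum>n. f n \<omega>) = exp (- z * of_real (X \<omega>))" for \<omega>
  proof -
    have "(\<lambda>n. complex_of_real (exp (- R * X \<omega>)) * ((of_real (- X \<omega>) * (z - of_real R)) ^ n /\<^sub>R fact n)) sums
       (of_real (exp (- R * X \<omega>)) * exp (of_real (- X \<omega>) * (z - of_real R)))"
      by (intro sums_mult exp_converges)
    moreover have "complex_of_real (exp (- R * X \<omega>)) * exp (of_real (- X \<omega>) * (z - of_real R)) = exp (- z * of_real (X \<omega>))"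
      by (simp add: exp_of_real[symmetric] exp_add[symmetric] algebra_simps)
    moreover have "complex_of_real (exp (- R * X \<omega>)) * ((of_real (- X \<omega>) * (z - of_real R)) ^ n /\<^sub>R fact n) = f n \<omega>" for n
      by (simp only: f_def scaleR_conv_of_real power_mult_distrib divide_inverse of_real_inverse of_real_fact mult_ac)
    ultimately show ?thesis by (simp add: sums_iff)
  qed
  moreover have "integral\<^sup>L M (f n) = (LINT \<omega>|M. of_real (exp (- R * X \<omega>)) * (of_real (- X \<omega>) ^ n / fact n)) * (z - of_real R) ^ n" for n
    unfolding f_def by (rule integral_mult_left_zero)
  ultimately show ?thesis by simp
qed

text \<open>The discs with centre and radius R exhaust the right half plane as R > 0 varies. On each
  the transform is a power series, hence holomorphic, and it agrees with F on a real segment, so the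
  identity theorem applies.\<close>

lemma (in prob_space) laplace_continuation:
  fixes X :: "'a \<Rightarrow> real" and F :: "complex \<Rightarrow> complex"
  assumes X: "X \<in> borel_measurable M" "\<And>\<omega>. \<omega> \<in> space M \<Longrightarrow> 0 \<le> X \<omega>"
    and F: "F holomorphic_on {z. Re z > 0}"
    and eq: "\<And>u. u > 0 \<Longrightarrow> F (of_real u) = of_real (LINT \<omega>|M. exp (- u * X \<omega>))"
    and z: "Re z > 0"
  shows "(LINT \<omega>|M. exp (- z * of_real (X \<omega>))) = F z"
proof -
  \<comment> \<open>The disc of centre and radius R contains z iff norm z ^ 2 < 2 * R * Re z; this R
    is twice the threshold.\<close>
  define R where "R = norm z ^ 2 / Re z"
  have "norm z \<ge> Re z" by (rule complex_Re_le_cmod)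
  then have nz: "norm z > 0" using z by linarith
  then have R: "R > 0" using z by (simp add: R_def)
  have "norm (z - of_real R) ^ 2 < R ^ 2"
  proof -
    have "norm (z - of_real R) ^ 2 = norm z ^ 2 - 2 * R * Re z + R ^ 2"
      by (simp add: cmod_power2 power2_diff algebra_simps)
    also have "R * Re z = norm z ^ 2" using z by (simp add: R_def)
    then have "norm z ^ 2 - 2 * R * Re z + R ^ 2 = R ^ 2 - norm z ^ 2" by simp
    also have "\<dots> < R ^ 2" using nz by simp
    finally show ?thesis .
  qed
  then have zR: "norm (z - of_real R) < R" using R by (simp add: power_less_imp_less_base)
  have sub: "ball (of_real R) R \<subseteq> {z. Re z > 0}"
  proof
    fix w assume "w \<in> ball (complex_of_real R) R"
    then have "norm (of_real R - w) < R" by (simp add: dist_norm)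
    moreover have "Re (of_real R - w) \<le> norm (of_real R - w)" by (rule complex_Re_le_cmod)
    ultimately show "w \<in> {z. Re z > 0}" by simp
  qed
  define G where "G z = (LINT \<omega>|M. exp (- z * of_real (X \<omega>)))" for z :: complex
  have "G holomorphic_on ball (of_real R) R"
    unfolding G_def by (rule power_series_holomorphic, rule laplace_power_series[OF X R])
      (auto simp: dist_norm norm_minus_commute)
  then have hol: "(\<lambda>w. G w - F w) holomorphic_on ball (of_real R) R"
    using holomorphic_on_subset[OF F sub] by (intro holomorphic_intros)
  have "G z - F z = 0"
  proof (rule analytic_continuation[OF hol, of "of_real ` {0<..<R}" "of_real (R/2)"])
    show "complex_of_real ` {0<..<R} \<subseteq> ball (of_real R) R"
      by (auto simp: dist_norm simp flip: of_real_diff)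
    show "complex_of_real (R/2) \<in> ball (of_real R) R"
      using R by (simp add: dist_norm flip: of_real_diff of_real_divide)
    have "(R/2) islimpt {0<..<R}" using R by (simp add: interior_limit_point interior_open)
    then show "complex_of_real (R / 2) islimpt complex_of_real ` {0<..<R}"
      by (rule islimpt_isCont_image) (auto simp: eventually_at simp del: of_real_divide intro!: exI[of _ 1])
    show "z \<in> ball (of_real R) R" using zR by (simp add: dist_norm norm_minus_commute)
    fix w assume "w \<in> complex_of_real ` {0<..<R}"
    then obtain u where u: "w = of_real u" "u > 0" by auto
    have "G w = (LINT \<omega>|M. of_real (exp (- u * X \<omega>)))"
      unfolding G_def u(1) by (intro Bochner_Integration.integral_cong refl) (simp flip: exp_of_real)
    then show "G w - F w = 0" using eq[OF u(2)] u(1) by simp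
  qed (use R in auto)
  then show ?thesis by (simp add: G_def)
qed

lemma (in prob_space) tempered_stable_laplace_complex:
  fixes z :: complex
  assumes X: "X \<in> borel_measurable M" "\<And>\<omega>. \<omega> \<in> space M \<Longrightarrow> 0 \<le> X \<omega>"
    and L: "\<And>u. 0 \<le> u \<Longrightarrow> (LINT \<omega>|M. exp (- u * X \<omega>)) = exp (- t * ((u + \<theta>) powr \<alpha> - \<theta> powr \<alpha>))"
    and \<theta>: "0 < \<theta>" and z: "0 < Re z \<or> z = 0"
  shows "(LINT \<omega>|M. exp (- z * of_real (X \<omega>))) =
     exp (- of_real t * ((z + of_real \<theta>) powr of_real \<alpha> - of_real (\<theta> powr \<alpha>)))"
proof (cases "z = 0")
  case True
  have "complex_of_real \<theta> powr of_real \<alpha> = of_real (\<theta> powr \<alpha>)"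
    using \<theta> by (intro powr_of_real) simp_all
  with True show ?thesis by (simp add: prob_space)
next
  case False
  show ?thesis
  proof (rule laplace_continuation[OF X])
    have "z + of_real \<theta> \<notin> \<real>\<^sub>\<le>\<^sub>0" if "0 < Re z" for z
      using that \<theta> by (auto simp: complex_nonpos_Reals_iff)
    then show "(\<lambda>z. exp (- of_real t * ((z + of_real \<theta>) powr of_real \<alpha> - of_real (\<theta> powr \<alpha>)))) holomorphic_on {z. 0 < Re z}"
      by (intro holomorphic_intros) auto
    fix u :: real assume u: "0 < u"
    have p: "(of_real u + of_real \<theta>) powr of_real \<alpha> = complex_of_real ((u + \<theta>) powr \<alpha>)"
      using powr_of_real[of "u + \<theta>" \<alpha>] u \<theta> by simp
    show "exp (- of_real t * ((of_real u + of_real \<theta>) powr of_real \<alpha> - of_real (\<theta> powr \<alpha>))) =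
        complex_of_real (LINT \<omega>|M. exp (- u * X \<omega>))"
      unfolding p L[OF less_imp_le[OF u]] exp_of_real[symmetric] by simp
  qed (use z False in auto)
qed

lemma iexp_eq_1_iff_Re: "Re (iexp x) = 1 \<longleftrightarrow> iexp x = 1"
proof
  assume r: "Re (iexp x) = 1"
  have "norm (iexp x) = 1" by simp
  then have "(Re (iexp x))\<^sup>2 + (Im (iexp x))\<^sup>2 = 1" by (simp add: cmod_def)
  with r have "Im (iexp x) = 0" by simp
  with r show "iexp x = 1" by (simp add: complex_eq_iff)
qed simp

text \<open>Both summands have nonnegative real part, so Re z = 0 forces each exponential to have
  real part 1, hence, being of modulus 1, to equal 1.\<close>

lemma poisson_exponent_half_plane:
  fixes l1 l2 x y :: real
  assumes l: "0 < l1" "0 < l2"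
  defines "z \<equiv> of_real l1 * (1 - iexp x) + of_real l2 * (1 - iexp y)"
  shows "0 < Re z \<or> z = 0"
proof -
  have "Re (iexp x) \<le> 1" "Re (iexp y) \<le> 1"
    using complex_Re_le_cmod[of "iexp x"] complex_Re_le_cmod[of "iexp y"] by simp_all
  then have nn: "0 \<le> l1 * (1 - Re (iexp x))" "0 \<le> l2 * (1 - Re (iexp y))"
    using l by (auto intro!: mult_nonneg_nonneg)
  have Re: "Re z = l1 * (1 - Re (iexp x)) + l2 * (1 - Re (iexp y))"
    by (simp add: z_def)
  show ?thesis
  proof (cases "Re z = 0")
    case True
    then have "l1 * (1 - Re (iexp x)) = 0" "l2 * (1 - Re (iexp y)) = 0" using nn unfolding Re by linarith+
    then have "Re (iexp x) = 1" "Re (iexp y) = 1" using l by simp_all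
    then have "z = 0" by (simp add: z_def iexp_eq_1_iff_Re del: Re_exp)
    then show ?thesis ..
  next
    case False
    then show ?thesis using nn unfolding Re by linarith
  qed
qed

section \<open>Sums as integrals\<close>

lemma has_sum_integral_count_space:
  fixes f :: "'a \<Rightarrow> 'b::{banach,second_countable_topology}"
  assumes f: "(f has_sum S) A" and s: "(\<lambda>x. norm (f x)) summable_on A"
  shows "integrable (count_space A) f" "integral\<^sup>L (count_space A) f = S"
proof -
  show i: "integrable (count_space A) f"
    using s unfolding abs_summable_equivalent abs_summable_on_def .
  have "integral\<^sup>L (count_space A) f = infsetsum f A" by (simp add: infsetsum_def)
  also have "\<dots> = infsum f A" using i by (intro infsetsum_infsum) (simp add: abs_summable_on_def)
  finally show "integral\<^sup>L (count_space A) f = S" using f by (simp add: infsumI)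
qed

text \<open>Links the \<open>ennreal\<close> sum of the final statement to integrals over counting
  measure. Summability makes the value finite, so both can be compared with the real sum.\<close>

lemma nn_integral_count_space_ennreal_infsum:
  fixes f :: "'a \<Rightarrow> real"
  assumes f: "f summable_on A" "\<And>x. x \<in> A \<Longrightarrow> 0 \<le> f x"
  shows "(\<integral>\<^sup>+ x. ennreal (f x) \<partial>count_space A) = (\<Sum>\<^sub>\<infinity>x\<in>A. ennreal (f x))"
proof -
  have n: "(\<lambda>x. norm (f x)) summable_on A"
    using f(1) by (rule summable_on_cong[THEN iffD1, rotated]) (use f(2) in auto)
  have "(\<integral>\<^sup>+ x. ennreal (f x) \<partial>count_space A) = ennreal (infsum f A)"
    using has_sum_integral_count_space[OF has_sum_infsum[OF f(1)] n] f(2)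
    by (subst nn_integral_eq_integral) (auto simp: AE_count_space)
  also have "\<dots> = infsum (ennreal \<circ> f) A"
    using f by (subst infsum_comm_additive_general[where f = ennreal]) (auto simp: sum_ennreal subset_iff o_def intro!: sum_ennreal[symmetric])
  finally show ?thesis by (simp add: o_def)
qed

section \<open>Poisson processes\<close>

lemma poisson_pmf_char:
  assumes r: "r > 0" and z: "norm (z :: complex) \<le> 1"
  shows "(LINT k|measure_pmf (poisson_pmf r). z ^ k) = exp (of_real r * (z - 1))"
proof -
  have "(LINT k|measure_pmf (poisson_pmf r). z ^ k) = (LINT k|count_space UNIV. pmf (poisson_pmf r) k *\<^sub>R z ^ k)"
    unfolding measure_pmf_eq_density by (subst integral_density) auto
  also have "\<dots> = exp (of_real r * (z - 1))"
  proof (rule has_sum_integral_count_space)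
    have s: "(\<lambda>k. of_real (exp (- r)) * ((of_real r * z) ^ k /\<^sub>R fact k)) sums (of_real (exp (- r)) * exp (of_real r * z))"
      by (intro sums_mult exp_converges)
    have eq: "(\<lambda>k. of_real (exp (- r)) * ((of_real r * z) ^ k /\<^sub>R fact k)) = (\<lambda>k. pmf (poisson_pmf r) k *\<^sub>R z ^ k)"
      using r by (auto simp: fun_eq_iff scaleR_conv_of_real power_mult_distrib field_simps)
    have e: "complex_of_real (exp (- r)) * exp (of_real r * z) = exp (of_real r * (z - 1))"
      by (simp add: exp_of_real[symmetric] exp_add[symmetric] algebra_simps)
    have ns: "summable (\<lambda>k. norm (pmf (poisson_pmf r) k *\<^sub>R z ^ k))"
    proof (rule summable_comparison_test)
      have "summable (\<lambda>k. exp (- r) * (r ^ k /\<^sub>R fact k))" by (intro summable_mult summable_exp_generic)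
      then show "summable (\<lambda>k. pmf (poisson_pmf r) k)" using r by (simp add: field_simps)
      show "\<exists>N. \<forall>n\<ge>N. norm (norm (pmf (poisson_pmf r) n *\<^sub>R z ^ n)) \<le> pmf (poisson_pmf r) n"
        using z by (auto simp: norm_power power_le_one simp del: pmf_poisson intro!: mult_left_le)
    qed
    show "((\<lambda>k. pmf (poisson_pmf r) k *\<^sub>R z ^ k) has_sum exp (of_real r * (z - 1))) UNIV"
      using norm_summable_imp_has_sum[OF ns] s unfolding eq e by auto
    show "(\<lambda>k. norm (pmf (poisson_pmf r) k *\<^sub>R z ^ k)) summable_on UNIV"
      using ns by (intro summable_nonneg_imp_summable_on) auto
  qed
  finally show ?thesis .
qed

lemma poisson_process_char:
  assumes N: "poisson_process M r N" and r: "0 < r" and s: "0 \<le> s" and z: "norm (z :: complex) \<le> 1"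
  shows "(LINT \<omega>|M. z ^ N s \<omega>) = exp (of_real (r * s) * (z - 1))"
proof (cases "s = 0")
  \<comment> \<open>The Poisson law is prescribed at positive times only; at time 0 the process
    vanishes.\<close>
  case True
  have "prob_space M" "\<And>\<omega>. \<omega> \<in> space M \<Longrightarrow> N 0 \<omega> = 0"
    using N by (auto simp: poisson_process_def levy_process_def)
  then have "(LINT \<omega>|M. z ^ N s \<omega>) = (LINT \<omega>|M. 1)"
    using True by (intro Bochner_Integration.integral_cong) auto
  then show ?thesis using True \<open>prob_space M\<close> by (simp add: prob_space.prob_space)
next
  case False
  with s have s: "s > 0" by simp
  have d: "distr M (count_space UNIV) (N s) = measure_pmf (poisson_pmf (r * s))"
    using N s by (simp add: poisson_process_def)
  \<comment> \<open>\<open>levy_process\<close> gives measurability of the real-valued process; the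
    floor brings it back to \<open>nat\<close>.\<close>
  have "N s \<in> measurable M (count_space UNIV)"
  proof -
    have m[measurable]: "(\<lambda>\<omega>. real (N s \<omega>)) \<in> borel_measurable M" using N s by (simp add: poisson_process_def levy_process_def)
    have "(\<lambda>\<omega>. nat \<lfloor>real (N s \<omega>)\<rfloor>) \<in> measurable M (count_space UNIV)" by measurable
    then show ?thesis by simp
  qed
  then have "(LINT \<omega>|M. z ^ N s \<omega>) = (LINT k|distr M (count_space UNIV) (N s). z ^ k)"
    by (subst integral_distr) auto
  then show ?thesis unfolding d using poisson_pmf_char[of "r * s" z] r s z by simp
qed

section \<open>Evaluation of random paths\<close>

text \<open>The evaluation map at a random time is not measurable on the product space of all paths.
  For right continuous paths it is the limit of evaluations at countably many times, which is
  measurable.\<close>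

definition right_approx :: "nat \<Rightarrow> real \<Rightarrow> real" where
  "right_approx m s = (of_int \<lfloor>of_nat (Suc m) * s\<rfloor> + 1) / of_nat (Suc m)"

text \<open>The inequality is strict even when s is a grid point, since \<open>right_approx\<close>
  takes floor plus one and not the ceiling. Convergence along \<open>at_right s\<close> depends on
  this.\<close>

lemma right_approx_gt: "s < right_approx m s"
proof -
  have "of_nat (Suc m) * s < of_int \<lfloor>of_nat (Suc m) * s\<rfloor> + 1" by linarith
  then show ?thesis unfolding right_approx_def by (simp add: field_simps)
qed

lemma right_approx_le: "right_approx m s \<le> s + 1 / of_nat (Suc m)"
proof -
  have "of_int \<lfloor>of_nat (Suc m) * s\<rfloor> + 1 \<le> of_nat (Suc m) * s + 1" by linarith
  then have "right_approx m s \<le> (of_nat (Suc m) * s + 1) / of_nat (Suc m)"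
    unfolding right_approx_def by (intro divide_right_mono) auto
  then show ?thesis by (simp add: add_divide_distrib)
qed

lemma filterlim_right_approx: "filterlim (\<lambda>m. right_approx m s) (at_right s) sequentially"
proof -
  have "(\<lambda>m. right_approx m s) \<longlonglongrightarrow> s"
  proof (rule tendsto_sandwich[of "\<lambda>_. s" _ _ "\<lambda>m. s + 1 / of_nat (Suc m)"])
    have "(\<lambda>m. s + 1 / of_nat (Suc m)) \<longlonglongrightarrow> s + 0"
      by (intro tendsto_add tendsto_const LIMSEQ_Suc[OF lim_1_over_n])
    then show "(\<lambda>m. s + 1 / of_nat (Suc m)) \<longlonglongrightarrow> s" by simp
  qed (use right_approx_gt right_approx_le in \<open>auto intro!: always_eventually intro: less_imp_le\<close>)
  moreover have "right_approx m s \<noteq> s" for m using right_approx_gt[of s m] by simp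
  ultimately show ?thesis
    using right_approx_gt by (auto simp: filterlim_at)
qed

text \<open>The cut-off at 0 keeps all sampled times in the index set \<open>{0..}\<close>, so
  evaluation is jointly measurable in path and time for every real s. For right continuous paths and
  s \<ge> 0 the limit is the value at s.\<close>

definition path_at :: "(real \<Rightarrow> real) \<Rightarrow> real \<Rightarrow> real" where
  "path_at y s = lim (\<lambda>m. y (max 0 (right_approx m s)))"

lemma path_at_eq:
  assumes "(y \<longlongrightarrow> y s) (at_right s)" "0 \<le> s"
  shows "path_at (restrict y {0..}) s = y s"
proof -
  have nonneg: "0 \<le> right_approx m s" for m using right_approx_gt[of s m] assms(2) by linarith
  have "(\<lambda>m. y (right_approx m s)) \<longlonglongrightarrow> y s"
    using filterlim_compose[OF assms(1) filterlim_right_approx] .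
  then show ?thesis unfolding path_at_def by (simp add: nonneg max_absorb2 limI)
qed

abbreviation path_space :: "(real \<Rightarrow> real) measure" where
  "path_space \<equiv> PiM {0..} (\<lambda>_. borel)"

text \<open>With countably many possible times, evaluation is glued from coordinate maps, each
  measurable on the product space.\<close>

lemma measurable_eval_discrete:
  assumes F[measurable]: "f \<in> measurable N path_space" and s: "s \<in> borel_measurable N"
    and c: "countable C" "\<And>x. x \<in> space N \<Longrightarrow> s x \<in> C" and C: "C \<subseteq> {0..}"
  shows "(\<lambda>x. f x (s x)) \<in> borel_measurable N"
proof (rule measurable_compose_countable'[where g = s and I = C])
  show "(\<lambda>x. f x t) \<in> borel_measurable N" if "t \<in> C" for t
    using that C measurable_compose[OF F measurable_component_singleton[of t "{0..}" "\<lambda>_. borel"]] by auto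
  show "s \<in> measurable N (count_space C)"
  proof (rule measurable_count_space_eq_countable[THEN iffD2, OF c(1)], intro conjI ballI)
    show "s \<in> space N \<rightarrow> C" using c by auto
    fix a
    show "s -` {a} \<inter> space N \<in> sets N" using s by (rule measurable_sets) auto
  qed
qed (rule c)

lemma measurable_path_at[measurable (raw)]:
  assumes F[measurable]: "f \<in> measurable N path_space" and s[measurable]: "s \<in> borel_measurable N"
  shows "(\<lambda>x. path_at (f x) (s x)) \<in> borel_measurable N"
  unfolding path_at_def
proof (rule borel_measurable_lim_metric)
  fix m
  let ?C = "(\<lambda>i::int. max 0 ((of_int i + 1) / of_nat (Suc m))) ` UNIV :: real set"
  show "(\<lambda>x. f x (max 0 (right_approx m (s x)))) \<in> borel_measurable N"
    by (rule measurable_eval_discrete[OF F, where C = ?C]) (auto simp: right_approx_def)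
qed

section \<open>Subordination of a pair of independent processes\<close>

text \<open>Fubini on the product of the two laws. It stands in for conditioning on X: the value
  \<open>X \<omega>\<close> is frozen while Y varies with the second sample point.\<close>

lemma (in prob_space) indep_var_expectation_iterated:
  fixes f :: "_ \<Rightarrow> 'b::{banach,second_countable_topology}"
  assumes i: "indep_var A X B Y" and f[measurable]: "f \<in> borel_measurable (A \<Otimes>\<^sub>M B)"
    and b: "\<And>p. norm (f p) \<le> C"
  shows "(LINT \<omega>|M. f (X \<omega>, Y \<omega>)) = (LINT \<omega>|M. LINT \<omega>'|M. f (X \<omega>, Y \<omega>'))"
proof -
  have [measurable]: "X \<in> measurable M A" "Y \<in> measurable M B"
    and d: "distr M (A \<Otimes>\<^sub>M B) (\<lambda>\<omega>. (X \<omega>, Y \<omega>)) = distr M A X \<Otimes>\<^sub>M distr M B Y"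
    using i unfolding indep_var_distribution_eq by auto
  interpret X: prob_space "distr M A X" by (rule prob_space_distr) simp
  interpret Y: prob_space "distr M B Y" by (rule prob_space_distr) simp
  interpret XY: pair_prob_space "distr M A X" "distr M B Y" ..
  have int: "integrable (distr M A X \<Otimes>\<^sub>M distr M B Y) f"
    by (rule XY.integrable_const_bound[of _ C]) (use b in auto)
  have "(LINT \<omega>|M. f (X \<omega>, Y \<omega>)) = integral\<^sup>L (distr M (A \<Otimes>\<^sub>M B) (\<lambda>\<omega>. (X \<omega>, Y \<omega>))) f"
    by (subst integral_distr) auto
  also have "\<dots> = (LINT x|distr M A X. LINT y|distr M B Y. f (x, y))"
    unfolding d using XY.integral_fst'[OF int] by simp
  also have "\<dots> = (LINT \<omega>|M. LINT y|distr M B Y. f (X \<omega>, y))"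
    by (subst integral_distr) auto
  also have "\<dots> = (LINT \<omega>|M. LINT \<omega>'|M. f (X \<omega>, Y \<omega>'))"
  proof (rule Bochner_Integration.integral_cong[OF refl])
    fix \<omega> assume "\<omega> \<in> space M"
    then have [simp]: "X \<omega> \<in> space A" by (rule measurable_space[rotated]) simp
    show "(LINT y|distr M B Y. f (X \<omega>, y)) = (LINT \<omega>'|M. f (X \<omega>, Y \<omega>'))"
      by (subst integral_distr) auto
  qed
  finally show ?thesis .
qed

abbreviation path_of :: "(real \<Rightarrow> 'a \<Rightarrow> real) \<Rightarrow> 'a \<Rightarrow> real \<Rightarrow> real" where
  "path_of X \<omega> \<equiv> (\<lambda>t\<in>{0..}. X t \<omega>)"

lemma path_of_at:
  assumes "levy_process M X" "\<omega> \<in> space M" "0 \<le> t"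
  shows "path_at (path_of X \<omega>) t = X t \<omega>"
  using assms by (intro path_at_eq) (auto simp: levy_process_def)

lemma partition_nonneg:
  fixes \<tau> :: "nat \<Rightarrow> real"
  assumes "0 \<le> \<tau> 0" "\<And>i. i < n \<Longrightarrow> \<tau> i \<le> \<tau> (Suc i)" "i \<le> n"
  shows "0 \<le> \<tau> i"
  using assms(3) by (induction i) (use assms(1,2) in \<open>auto intro: order_trans\<close>)

text \<open>Independence of the increments factors the expectation, stationarity moves each factor
  to start at time 0. It is applied to X and Y at times read off a frozen path of S, and to S itself
  with \<open>G\<close> as test function.\<close>

lemma (in prob_space) levy_increments_expectation:
  fixes \<phi> :: "nat \<Rightarrow> real \<Rightarrow> complex"
  assumes Z: "levy_process M Z" and s: "0 \<le> \<sigma> 0" "\<And>i. i < n \<Longrightarrow> \<sigma> i \<le> \<sigma> (Suc i)"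
    and \<phi>[measurable]: "\<And>i. \<phi> i \<in> borel_measurable borel" and b: "\<And>i x. norm (\<phi> i x) \<le> 1"
  shows "(LINT \<omega>|M. (\<Prod>i<n. \<phi> i (Z (\<sigma> (Suc i)) \<omega> - Z (\<sigma> i) \<omega>))) = (\<Prod>i<n. LINT \<omega>|M. \<phi> i (Z (\<sigma> (Suc i) - \<sigma> i) \<omega>))"
proof -
  have pos: "0 \<le> \<sigma> i" if "i \<le> n" for i
    using s that by (rule partition_nonneg)
  have m[measurable]: "0 \<le> t \<Longrightarrow> Z t \<in> borel_measurable M" for t using Z by (simp add: levy_process_def)
  have iv: "indep_vars (\<lambda>_. borel) (\<lambda>i \<omega>. Z (\<sigma> (Suc i)) \<omega> - Z (\<sigma> i) \<omega>) {..<n}"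
    using Z s by (simp add: levy_process_def)
  have mi: "(\<lambda>\<omega>. Z (\<sigma> (Suc i)) \<omega> - Z (\<sigma> i) \<omega>) \<in> borel_measurable M" if "i < n" for i
    using that by (intro borel_measurable_diff m pos) auto
  have "indep_vars (\<lambda>_. borel) (\<lambda>i \<omega>. \<phi> i (Z (\<sigma> (Suc i)) \<omega> - Z (\<sigma> i) \<omega>)) {..<n}"
    by (rule indep_vars_compose2[OF iv]) simp
  then have "(LINT \<omega>|M. (\<Prod>i<n. \<phi> i (Z (\<sigma> (Suc i)) \<omega> - Z (\<sigma> i) \<omega>))) = (\<Prod>i<n. LINT \<omega>|M. \<phi> i (Z (\<sigma> (Suc i)) \<omega> - Z (\<sigma> i) \<omega>))"
    using mi b by (intro indep_vars_lebesgue_integral) (auto intro!: integrable_const_bound[of _ 1] measurable_compose[OF _ \<phi>])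
  also have "\<dots> = (\<Prod>i<n. LINT \<omega>|M. \<phi> i (Z (\<sigma> (Suc i) - \<sigma> i) \<omega>))"
  proof (rule prod.cong[OF refl])
    fix i assume "i \<in> {..<n}"
    then have i: "0 \<le> \<sigma> i" "\<sigma> i \<le> \<sigma> (Suc i)" "i < n" using s pos by auto
    have st: "\<And>s h. 0 \<le> s \<Longrightarrow> 0 \<le> h \<Longrightarrow> distr M borel (\<lambda>\<omega>. Z (s + h) \<omega> - Z s \<omega>) = distr M borel (Z h)"
      using Z unfolding levy_process_def by blast
    have d: "distr M borel (\<lambda>\<omega>. Z (\<sigma> (Suc i)) \<omega> - Z (\<sigma> i) \<omega>) = distr M borel (Z (\<sigma> (Suc i) - \<sigma> i))"
      using st[of "\<sigma> i" "\<sigma> (Suc i) - \<sigma> i"] i by simp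
    have "(LINT \<omega>|M. \<phi> i (Z (\<sigma> (Suc i)) \<omega> - Z (\<sigma> i) \<omega>)) = integral\<^sup>L (distr M borel (\<lambda>\<omega>. Z (\<sigma> (Suc i)) \<omega> - Z (\<sigma> i) \<omega>)) (\<phi> i)"
      using mi[OF i(3)] by (subst integral_distr) auto
    also have "\<dots> = (LINT \<omega>|M. \<phi> i (Z (\<sigma> (Suc i) - \<sigma> i) \<omega>))"
      unfolding d using i by (subst integral_distr) auto
    finally show "(LINT \<omega>|M. \<phi> i (Z (\<sigma> (Suc i)) \<omega> - Z (\<sigma> i) \<omega>)) = (LINT \<omega>|M. \<phi> i (Z (\<sigma> (Suc i) - \<sigma> i) \<omega>))" .
  qed
  finally show ?thesis .
qed

text \<open>Independence concerns whole paths, since the evaluation time is random. Any subordinator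
  and any two real Levy processes are covered; the Poisson and stable laws enter only when
  \<open>Q_char\<close> is evaluated.\<close>

locale subordinated_pair = prob_space M for M :: "'a measure" +
  fixes S X Y :: "real \<Rightarrow> 'a \<Rightarrow> real"
  assumes S: "subordinator M S" and X: "levy_process M X" and Y: "levy_process M Y"
    and indep: "indep_vars (\<lambda>_. path_space) (\<lambda>i. path_of ([S, X, Y] ! i)) {..<3::nat}"
begin

definition Q :: "real \<Rightarrow> 'a \<Rightarrow> real \<times> real" where
  "Q t \<omega> = (X (S t \<omega>) \<omega>, Y (S t \<omega>) \<omega>)"

lemma S_levy: "levy_process M S"
  using S by (simp add: subordinator_def)

lemma S_mono: "\<omega> \<in> space M \<Longrightarrow> 0 \<le> s \<Longrightarrow> s \<le> t \<Longrightarrow> S s \<omega> \<le> S t \<omega>"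
  using S by (simp add: subordinator_def)

lemma S_nonneg: "\<omega> \<in> space M \<Longrightarrow> 0 \<le> t \<Longrightarrow> 0 \<le> S t \<omega>"
  using S_mono[of \<omega> 0 t] S_levy by (simp add: levy_process_def)

lemma S_measurable[measurable]: "0 \<le> t \<Longrightarrow> S t \<in> borel_measurable M"
  using S_levy by (simp add: levy_process_def)

lemma path_measurable[measurable]:
  "path_of S \<in> measurable M path_space" "path_of X \<in> measurable M path_space" "path_of Y \<in> measurable M path_space"
proof -
  have "path_of ([S, X, Y] ! i) \<in> measurable M path_space" if "i < 3" for i
    using indep that by (simp add: indep_vars_def)
  from this[of 0] this[of 1] this[of 2] show
    "path_of S \<in> measurable M path_space" "path_of X \<in> measurable M path_space" "path_of Y \<in> measurable M path_space"
    by simp_all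
qed

lemma indep_XY: "indep_var path_space (path_of X) path_space (path_of Y)"
proof -
  have "indep_var path_space ((\<lambda>p. p 1) \<circ> (\<lambda>\<omega>. restrict (\<lambda>i. path_of ([S, X, Y] ! i) \<omega>) {1::nat}))
      path_space ((\<lambda>p. p 2) \<circ> (\<lambda>\<omega>. restrict (\<lambda>i. path_of ([S, X, Y] ! i) \<omega>) {2}))"
    by (rule indep_var_compose[OF indep_var_restrict[OF indep]]) (auto intro!: measurable_component_singleton)
  then show ?thesis by (simp add: o_def)
qed

lemma indep_S_XY:
  "indep_var (PiM {0} (\<lambda>_. path_space)) (\<lambda>\<omega>. \<lambda>i\<in>{0}. path_of ([S, X, Y] ! i) \<omega>)
     (PiM {1, 2} (\<lambda>_. path_space)) (\<lambda>\<omega>. \<lambda>i\<in>{1, 2}. path_of ([S, X, Y] ! i) \<omega>)"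
  by (rule indep_var_restrict[OF indep]) auto

lemma subordinated_eq:
  assumes "\<omega> \<in> space M" "0 \<le> t"
  shows "X (S t \<omega>) \<omega> = path_at (path_of X \<omega>) (S t \<omega>)" "Y (S t \<omega>) \<omega> = path_at (path_of Y \<omega>) (S t \<omega>)"
  using path_of_at[OF X assms(1) S_nonneg[OF assms]] path_of_at[OF Y assms(1) S_nonneg[OF assms]] by simp_all

lemma subordinated_measurable[measurable]:
  assumes [simp]: "0 \<le> t"
  shows "(\<lambda>\<omega>. X (S t \<omega>) \<omega>) \<in> borel_measurable M" "(\<lambda>\<omega>. Y (S t \<omega>) \<omega>) \<in> borel_measurable M"
proof -
  have "(\<lambda>\<omega>. path_at (path_of X \<omega>) (S t \<omega>)) \<in> borel_measurable M"
    "(\<lambda>\<omega>. path_at (path_of Y \<omega>) (S t \<omega>)) \<in> borel_measurable M"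
    by measurable
  then show "(\<lambda>\<omega>. X (S t \<omega>) \<omega>) \<in> borel_measurable M" "(\<lambda>\<omega>. Y (S t \<omega>) \<omega>) \<in> borel_measurable M"
    using subordinated_eq by (simp_all cong: measurable_cong)
qed

lemma Q_measurable[measurable]: "0 \<le> t \<Longrightarrow> Q t \<in> borel_measurable M"
  unfolding Q_def[abs_def] by simp

text \<open>For h \<ge> 0 the expectation of \<phi>(X h) \<psi>(Y h) for bounded Borel \<phi> and
  \<psi>, by independence, as a function of h. Writing it with \<open>path_at\<close> makes it Borel
  on the whole line, so that it can be composed with S.\<close>

definition G :: "(real \<Rightarrow> complex) \<Rightarrow> (real \<Rightarrow> complex) \<Rightarrow> real \<Rightarrow> complex" where
  "G \<phi> \<psi> h = (LINT \<omega>|M. \<phi> (path_at (path_of X \<omega>) h)) * (LINT \<omega>|M. \<psi> (path_at (path_of Y \<omega>) h))"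

lemma G_eq: "0 \<le> h \<Longrightarrow> G \<phi> \<psi> h = (LINT \<omega>|M. \<phi> (X h \<omega>)) * (LINT \<omega>|M. \<psi> (Y h \<omega>))"
  unfolding G_def by (intro arg_cong2[where f = "(*)"] Bochner_Integration.integral_cong)
    (simp_all add: path_of_at[OF X] path_of_at[OF Y])

lemma G_measurable[measurable]:
  assumes [measurable]: "\<phi> \<in> borel_measurable borel" "\<psi> \<in> borel_measurable borel"
  shows "G \<phi> \<psi> \<in> borel_measurable borel"
  unfolding G_def[abs_def] by measurable

lemma G_bounded:
  assumes "\<And>x. norm (\<phi> x) \<le> 1" "\<And>x. norm (\<psi> x) \<le> 1"
  shows "norm (G \<phi> \<psi> h) \<le> 1"
proof -
  \<comment> \<open>Here Z is arbitrary: if the integrand is not integrable, its integral is 0 by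
    convention and the bound still holds.\<close>
  have "norm (LINT \<omega>|M. f (Z \<omega>)) \<le> 1" if "\<And>x. norm (f x) \<le> 1" for f :: "real \<Rightarrow> complex" and Z
  proof (cases "integrable M (\<lambda>\<omega>. f (Z \<omega>))")
    case True
    then have "norm (LINT \<omega>|M. f (Z \<omega>)) \<le> (LINT \<omega>|M. norm (f (Z \<omega>)))" by (intro integral_norm_bound)
    also have "\<dots> \<le> (LINT \<omega>|M. 1)" using True that by (intro integral_mono) auto
    finally show ?thesis by (simp add: prob_space)
  qed (simp add: not_integrable_integral_eq)
  from this[of \<phi>] this[of \<psi>] assms show ?thesis
    unfolding G_def norm_mult by (intro mult_le_one) auto
qed

text \<open>Freezing the path of S turns the random times into fixed nondecreasing ones.
  Independence of X and Y then splits the inner expectation, their increments turn it into a product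
  of values of \<open>G\<close> at increments of S, and the increments of S factor the outer
  expectation.\<close>

lemma subordinated_increments_expectation:
  fixes \<phi> \<psi> :: "nat \<Rightarrow> real \<Rightarrow> complex"
  assumes t: "0 \<le> \<tau> 0" "\<And>i. i < n \<Longrightarrow> \<tau> i \<le> \<tau> (Suc i)"
    and \<phi>[measurable]: "\<And>i. \<phi> i \<in> borel_measurable borel" "\<And>i. \<psi> i \<in> borel_measurable borel"
    and b: "\<And>i x. norm (\<phi> i x) \<le> 1" "\<And>i x. norm (\<psi> i x) \<le> 1"
  shows "(LINT \<omega>|M. (\<Prod>i<n. \<phi> i (fst (Q (\<tau> (Suc i)) \<omega> - Q (\<tau> i) \<omega>)) * \<psi> i (snd (Q (\<tau> (Suc i)) \<omega> - Q (\<tau> i) \<omega>))))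
     = (\<Prod>i<n. LINT \<omega>|M. G (\<phi> i) (\<psi> i) (S (\<tau> (Suc i) - \<tau> i) \<omega>))"
proof -
  have pos: "0 \<le> \<tau> i" if "i \<le> n" for i
    using t that by (rule partition_nonneg)
  define F where "F s x = (\<Prod>i<n. \<phi> i (path_at x (s (\<tau> (Suc i))) - path_at x (s (\<tau> i))))" for s x
  define H where "H s x = (\<Prod>i<n. \<psi> i (path_at x (s (\<tau> (Suc i))) - path_at x (s (\<tau> i))))" for s x
  \<comment> \<open>\<open>indep_S_XY\<close> is about tuples of paths indexed by {0} and {1, 2}:
    \<open>P\<close> forms them, and \<open>K\<close> reads the paths back.\<close>
  define P where "P A \<omega> = (\<lambda>i\<in>A. path_of ([S, X, Y] ! i) \<omega>)" for A and \<omega> :: 'a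
  define K where "K q = F (fst q 0) (snd q 1) * H (fst q 0) (snd q 2)" for q :: "(nat \<Rightarrow> real \<Rightarrow> real) \<times> (nat \<Rightarrow> real \<Rightarrow> real)"
  have K: "K (P {0} \<omega>, P {1, 2} \<omega>') = F (path_of S \<omega>) (path_of X \<omega>') * H (path_of S \<omega>) (path_of Y \<omega>')" for \<omega> \<omega>'
    by (simp add: K_def P_def)
  have ev: "(\<lambda>p. f p (\<tau> i)) \<in> borel_measurable N" if "i \<le> n" "f \<in> measurable N path_space" for i and f :: "'c \<Rightarrow> real \<Rightarrow> real" and N
    using measurable_compose[OF that(2) measurable_component_singleton[of "\<tau> i" "{0..}" "\<lambda>_. borel"]] pos[OF that(1)] by simp
  have mF: "(\<lambda>p. F (f p) (g p)) \<in> borel_measurable N" "(\<lambda>p. H (f p) (g p)) \<in> borel_measurable N"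
    if "f \<in> measurable N path_space" "g \<in> measurable N path_space" for f g :: "'c \<Rightarrow> real \<Rightarrow> real" and N
    unfolding F_def H_def using that ev[OF _ that(1)]
    by (intro borel_measurable_prod measurable_compose[OF _ \<phi>(1)] measurable_compose[OF _ \<phi>(2)] borel_measurable_diff measurable_path_at; simp)+
  have bF: "norm (F s x) \<le> 1" "norm (H s x) \<le> 1" for s x
    unfolding F_def H_def prod_norm[symmetric] using b by (auto intro!: prod_le_1)
  have "(LINT \<omega>|M. (\<Prod>i<n. \<phi> i (fst (Q (\<tau> (Suc i)) \<omega> - Q (\<tau> i) \<omega>)) * \<psi> i (snd (Q (\<tau> (Suc i)) \<omega> - Q (\<tau> i) \<omega>))))
     = (LINT \<omega>|M. K (P {0} \<omega>, P {1, 2} \<omega>))"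
  proof (rule Bochner_Integration.integral_cong[OF refl])
    fix \<omega> assume "\<omega> \<in> space M"
    then show "(\<Prod>i<n. \<phi> i (fst (Q (\<tau> (Suc i)) \<omega> - Q (\<tau> i) \<omega>)) * \<psi> i (snd (Q (\<tau> (Suc i)) \<omega> - Q (\<tau> i) \<omega>)))
     = K (P {0} \<omega>, P {1, 2} \<omega>)"
      using pos unfolding K F_def H_def prod.distrib
      by (auto simp: Q_def subordinated_eq intro!: arg_cong2[where f = "(*)"] prod.cong)
  qed
  also have "\<dots> = (LINT \<omega>|M. LINT \<omega>'|M. K (P {0} \<omega>, P {1, 2} \<omega>'))"
  proof (rule indep_var_expectation_iterated[OF indep_S_XY[folded P_def], where C = 1])
    show "K \<in> borel_measurable (PiM {0} (\<lambda>_. path_space) \<Otimes>\<^sub>M PiM {1, 2} (\<lambda>_. path_space))"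
      unfolding K_def[abs_def]
      by (intro borel_measurable_times mF measurable_compose[OF measurable_fst] measurable_compose[OF measurable_snd]
        measurable_component_singleton) auto
    show "norm (K q) \<le> 1" for q
      unfolding K_def norm_mult by (intro mult_le_one bF norm_ge_zero)
  qed
  also have "\<dots> = (LINT \<omega>|M. (\<Prod>i<n. G (\<phi> i) (\<psi> i) (S (\<tau> (Suc i)) \<omega> - S (\<tau> i) \<omega>)))"
  proof (rule Bochner_Integration.integral_cong[OF refl])
    fix \<omega> assume w: "\<omega> \<in> space M"
    define \<sigma> where "\<sigma> i = S (\<tau> i) \<omega>" for i
    have s: "0 \<le> \<sigma> 0" "\<And>i. i < n \<Longrightarrow> \<sigma> i \<le> \<sigma> (Suc i)" "\<And>i. i \<le> n \<Longrightarrow> 0 \<le> \<sigma> i"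
      unfolding \<sigma>_def using t pos S_mono[OF w] S_nonneg[OF w] by auto
    have ps: "path_of S \<omega> \<in> space path_space" by (rule measurable_space[OF path_measurable(1) w])
    have m: "F (path_of S \<omega>) \<in> borel_measurable path_space" "H (path_of S \<omega>) \<in> borel_measurable path_space"
      by (rule mF[OF measurable_const[OF ps] measurable_ident[unfolded id_def]])+
    have i: "indep_var borel (\<lambda>\<omega>'. F (path_of S \<omega>) (path_of X \<omega>')) borel (\<lambda>\<omega>'. H (path_of S \<omega>) (path_of Y \<omega>'))"
      using indep_var_compose[OF indep_XY m] unfolding o_def .
    have "integrable M (\<lambda>\<omega>'. F (path_of S \<omega>) (path_of X \<omega>'))"
      by (rule integrable_const_bound[of _ 1, OF AE_I2[OF bF(1)] measurable_compose[OF path_measurable(2) m(1)]])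
    moreover have "integrable M (\<lambda>\<omega>'. H (path_of S \<omega>) (path_of Y \<omega>'))"
      by (rule integrable_const_bound[of _ 1, OF AE_I2[OF bF(2)] measurable_compose[OF path_measurable(3) m(2)]])
    ultimately have "(LINT \<omega>'|M. F (path_of S \<omega>) (path_of X \<omega>') * H (path_of S \<omega>) (path_of Y \<omega>')) =
      (LINT \<omega>'|M. F (path_of S \<omega>) (path_of X \<omega>')) * (LINT \<omega>'|M. H (path_of S \<omega>) (path_of Y \<omega>'))"
      by (rule indep_var_lebesgue_integral[OF i])
    also have "(LINT \<omega>'|M. F (path_of S \<omega>) (path_of X \<omega>')) = (LINT \<omega>'|M. (\<Prod>i<n. \<phi> i (X (\<sigma> (Suc i)) \<omega>' - X (\<sigma> i) \<omega>')))"
      unfolding F_def using pos s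
      by (intro Bochner_Integration.integral_cong refl prod.cong) (auto simp: \<sigma>_def[symmetric] path_of_at[OF X])
    also have "\<dots> = (\<Prod>i<n. LINT \<omega>|M. \<phi> i (X (\<sigma> (Suc i) - \<sigma> i) \<omega>))"
      by (rule levy_increments_expectation[OF X s(1,2) \<phi>(1) b(1)])
    also have "(LINT \<omega>'|M. H (path_of S \<omega>) (path_of Y \<omega>')) = (LINT \<omega>'|M. (\<Prod>i<n. \<psi> i (Y (\<sigma> (Suc i)) \<omega>' - Y (\<sigma> i) \<omega>')))"
      unfolding H_def using pos s
      by (intro Bochner_Integration.integral_cong refl prod.cong) (auto simp: \<sigma>_def[symmetric] path_of_at[OF Y])
    also have "\<dots> = (\<Prod>i<n. LINT \<omega>|M. \<psi> i (Y (\<sigma> (Suc i) - \<sigma> i) \<omega>))"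
      by (rule levy_increments_expectation[OF Y s(1,2) \<phi>(2) b(2)])
    also have "(\<Prod>i<n. LINT \<omega>|M. \<phi> i (X (\<sigma> (Suc i) - \<sigma> i) \<omega>)) * (\<Prod>i<n. LINT \<omega>|M. \<psi> i (Y (\<sigma> (Suc i) - \<sigma> i) \<omega>)) =
      (\<Prod>i<n. G (\<phi> i) (\<psi> i) (\<sigma> (Suc i) - \<sigma> i))"
      unfolding prod.distrib[symmetric] using s by (intro prod.cong refl) (simp add: G_eq)
    finally show "(LINT \<omega>'|M. K (P {0} \<omega>, P {1, 2} \<omega>')) =
      (\<Prod>i<n. G (\<phi> i) (\<psi> i) (S (\<tau> (Suc i)) \<omega> - S (\<tau> i) \<omega>))"
      unfolding K \<sigma>_def .
  qed
  also have "\<dots> = (\<Prod>i<n. LINT \<omega>|M. G (\<phi> i) (\<psi> i) (S (\<tau> (Suc i) - \<tau> i) \<omega>))"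
    by (rule levy_increments_expectation[OF S_levy t]) (use b in \<open>auto intro!: G_bounded\<close>)
  finally show ?thesis .
qed

end

section \<open>One-sided limits of composed paths, and rectangles in the plane\<close>

lemma tendsto_compose_at_right:
  fixes f :: "real \<Rightarrow> real" and x :: "real \<Rightarrow> 'b::topological_space"
  assumes f: "(f \<longlongrightarrow> f t) (at_right t)" "\<And>s. t < s \<Longrightarrow> f t \<le> f s"
    and x: "(x \<longlongrightarrow> x (f t)) (at_right (f t))"
  shows "((\<lambda>s. x (f s)) \<longlongrightarrow> x (f t)) (at_right t)"
proof -
  \<comment> \<open>To the right of t the inner path may rest at \<open>f t\<close>, so the limit
    along \<open>at_right\<close> has to be upgraded to continuity on the closed ray.\<close>
  have "continuous (at (f t) within {f t..}) x"
    using x by (simp add: continuous_within at_within_Ici_at_right)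
  moreover have "\<forall>\<^sub>F s in at_right t. f s \<in> {f t..}"
    using f(2) by (auto simp: eventually_at_filter)
  ultimately show ?thesis
    using f(1) by (rule continuous_within_tendsto_compose)
qed

text \<open>If the monotone f reaches its left limit l before t, it stays there until t and the
  composition is eventually \<open>x l\<close>. Otherwise f approaches l strictly from below, and
  the left limit of x at l applies.\<close>

lemma left_limit_compose:
  fixes f :: "real \<Rightarrow> real" and x :: "real \<Rightarrow> 'b::topological_space"
  assumes f: "(f \<longlongrightarrow> l) (at_left t)" "\<And>s s'. a \<le> s \<Longrightarrow> s \<le> s' \<Longrightarrow> f s \<le> f s'" and t: "a < t"
    and x: "\<And>r. f a < r \<Longrightarrow> \<exists>m. (x \<longlongrightarrow> m) (at_left r)"
  shows "\<exists>m. ((\<lambda>s. x (f s)) \<longlongrightarrow> m) (at_left t)"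
proof -
  have le: "f s \<le> l" if "a \<le> s" "s < t" for s
  proof (rule tendsto_lowerbound[OF f(1)])
    have "\<forall>\<^sub>F r in at_left t. r \<in> {s<..<t}" using that by (intro eventually_at_left_real)
    then show "\<forall>\<^sub>F r in at_left t. f s \<le> f r"
      by eventually_elim (use that f(2) in auto)
  qed simp
  show ?thesis
  proof (cases "\<exists>s. a \<le> s \<and> s < t \<and> f s = l")
    case True
    then obtain s where s: "a \<le> s" "s < t" "f s = l" by blast
    have "\<forall>\<^sub>F r in at_left t. r \<in> {s<..<t}" using s by (intro eventually_at_left_real)
    then have "\<forall>\<^sub>F r in at_left t. x (f r) = x l"
    proof eventually_elim
      case (elim r)
      then have "f s \<le> f r" "f r \<le> l" using f(2)[of s r] le[of r] s by auto
      then show ?case using s by simp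
    qed
    then show ?thesis by (intro exI[of _ "x l"]) (rule tendsto_eventually)
  next
    case False
    with le have less: "f s < l" if "a \<le> s" "s < t" for s using that by (meson order_le_less)
    have "\<forall>\<^sub>F r in at_left t. r \<in> {a<..<t}" using t by (intro eventually_at_left_real)
    then have "\<forall>\<^sub>F r in at_left t. f r < l" by eventually_elim (use less in auto)
    then have "\<forall>\<^sub>F r in at_left t. f r \<in> {..<l} \<and> f r \<noteq> l" by eventually_elim auto
    with f(1) have lim: "filterlim f (at_left l) (at_left t)" by (simp add: filterlim_at)
    obtain m where "(x \<longlongrightarrow> m) (at_left l)" using x[of l] less[of a] t by auto
    from filterlim_compose[OF this lim] show ?thesis by (rule exI)
  qed
qed

lemma sets_borel_prod_generator:
  "sets (borel :: ('a::second_countable_topology \<times> 'b::second_countable_topology) measure) =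
     sigma_sets UNIV {a \<times> b | a b. a \<in> sets borel \<and> b \<in> sets borel}"
  unfolding borel_prod[symmetric] by (simp add: sets_pair_measure)

lemma prod_of_bool: "(\<Prod>i<n. of_bool (P i)) = (of_bool (\<forall>i<n::nat. P i) :: 'a::comm_semiring_1)"
  by (induction n) (auto simp: less_Suc_eq)

lemma borel_rectangle:
  fixes a :: "'a::second_countable_topology set" and b :: "'b::second_countable_topology set"
  assumes "a \<in> sets borel" "b \<in> sets borel"
  shows "a \<times> b \<in> sets borel"
  using pair_measureI[OF assms] unfolding borel_prod .

section \<open>The subordinated pair is a Levy process\<close>

context subordinated_pair
begin

abbreviation ind :: "real set \<Rightarrow> real \<Rightarrow> complex" where
  "ind a x \<equiv> of_real (indicator a x)"

text \<open>The indicator of the event is a product of indicators of single coordinates of the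
  increments, which are admissible test functions.\<close>

lemma prob_increments_rectangles:
  assumes t: "0 \<le> \<tau> 0" "\<And>i. i < n \<Longrightarrow> \<tau> i \<le> \<tau> (Suc i)"
    and ab[measurable]: "\<And>i. a i \<in> sets borel" "\<And>i. b i \<in> sets borel"
  shows "of_real (prob {\<omega> \<in> space M. \<forall>i<n. Q (\<tau> (Suc i)) \<omega> - Q (\<tau> i) \<omega> \<in> a i \<times> b i}) =
    (\<Prod>i<n. LINT \<omega>|M. G (ind (a i)) (ind (b i)) (S (\<tau> (Suc i) - \<tau> i) \<omega>))"
proof -
  have pos: "0 \<le> \<tau> i" if "i \<le> n" for i
    using t that by (rule partition_nonneg)
  let ?E = "{\<omega> \<in> space M. \<forall>i<n. Q (\<tau> (Suc i)) \<omega> - Q (\<tau> i) \<omega> \<in> a i \<times> b i}"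
  have "{\<omega> \<in> space M. \<forall>i\<in>{..<n}. Q (\<tau> (Suc i)) \<omega> - Q (\<tau> i) \<omega> \<in> a i \<times> b i} \<in> sets M"
  proof (intro sets.sets_Collect_finite_All finite_lessThan)
    fix i assume i: "i \<in> {..<n}"
    have "(\<lambda>\<omega>. Q (\<tau> (Suc i)) \<omega> - Q (\<tau> i) \<omega>) \<in> borel_measurable M"
      using i by (intro borel_measurable_diff Q_measurable pos) auto
    from measurable_sets[OF this borel_rectangle[OF ab]]
    show "{\<omega> \<in> space M. Q (\<tau> (Suc i)) \<omega> - Q (\<tau> i) \<omega> \<in> a i \<times> b i} \<in> sets M"
      unfolding vimage_def Int_def mem_Collect_eq conj_commute[of _ "_ \<in> space M"] .
  qed
  then have E: "?E \<in> sets M" unfolding Ball_def lessThan_iff .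
  have "complex_of_real (prob A) = (LINT \<omega>|M. complex_of_real (indicator A \<omega>))" if "A \<in> sets M" for A
    using that by simp
  from this[OF E] have "of_real (prob ?E) = (LINT \<omega>|M. complex_of_real (indicator ?E \<omega>))" .
  also have "\<dots> = (LINT \<omega>|M. (\<Prod>i<n. ind (a i) (fst (Q (\<tau> (Suc i)) \<omega> - Q (\<tau> i) \<omega>)) * ind (b i) (snd (Q (\<tau> (Suc i)) \<omega> - Q (\<tau> i) \<omega>))))"
  proof (rule Bochner_Integration.integral_cong[OF refl])
    fix \<omega> assume w: "\<omega> \<in> space M"
    have "(\<Prod>i<n. ind (a i) (fst (Q (\<tau> (Suc i)) \<omega> - Q (\<tau> i) \<omega>)) * ind (b i) (snd (Q (\<tau> (Suc i)) \<omega> - Q (\<tau> i) \<omega>))) =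
      (\<Prod>i<n. of_bool (Q (\<tau> (Suc i)) \<omega> - Q (\<tau> i) \<omega> \<in> a i \<times> b i))"
      by (intro prod.cong refl) (simp add: indicator_def mem_Times_iff)
    also have "\<dots> = of_bool (\<forall>i<n. Q (\<tau> (Suc i)) \<omega> - Q (\<tau> i) \<omega> \<in> a i \<times> b i)"
      by (rule prod_of_bool)
    also have "\<dots> = of_real (indicator ?E \<omega>)"
      unfolding indicator_def mem_Collect_eq using w by simp
    finally show "complex_of_real (indicator ?E \<omega>) = (\<Prod>i<n. ind (a i) (fst (Q (\<tau> (Suc i)) \<omega> - Q (\<tau> i) \<omega>)) * ind (b i) (snd (Q (\<tau> (Suc i)) \<omega> - Q (\<tau> i) \<omega>)))"
      by (rule sym)
  qed
  also have "\<dots> = (\<Prod>i<n. LINT \<omega>|M. G (ind (a i)) (ind (b i)) (S (\<tau> (Suc i) - \<tau> i) \<omega>))"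
  proof (rule subordinated_increments_expectation[OF t])
    show "ind (a i) \<in> borel_measurable borel" "ind (b i) \<in> borel_measurable borel" for i
      by measurable
    show "norm (ind (a i) x) \<le> 1" "norm (ind (b i) x) \<le> 1" for i x
      by (simp_all add: indicator_def)
  qed
  finally show ?thesis .
qed

text \<open>A single step of the partition. The right side is free of s, which yields stationarity,
  and is of the form of the factors in the joint probability, which yields independence.\<close>

lemma prob_increment_rectangle:
  assumes "0 \<le> s" "0 \<le> h" "a \<in> sets borel" "b \<in> sets borel"
  shows "of_real (prob {\<omega> \<in> space M. Q (s + h) \<omega> - Q s \<omega> \<in> a \<times> b}) = (LINT \<omega>|M. G (ind a) (ind b) (S h \<omega>))"
  using prob_increments_rectangles[of "\<lambda>i. s + real i * h" 1 "\<lambda>_. a" "\<lambda>_. b"] assms by simp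

lemma Q_zero: "\<omega> \<in> space M \<Longrightarrow> Q 0 \<omega> = 0"
  using S_levy X Y by (simp add: Q_def levy_process_def zero_prod_def)

lemma Q_indep_increments:
  assumes t: "0 \<le> \<tau> 0" "\<And>i. i < n \<Longrightarrow> \<tau> i \<le> \<tau> (Suc i)"
  shows "indep_vars (\<lambda>_. borel) (\<lambda>i \<omega>. Q (\<tau> (Suc i)) \<omega> - Q (\<tau> i) \<omega>) {..<n}"
\<comment> \<open>\<open>indep_vars_finite\<close> is applied to a nonempty index set, so the empty
  family is treated apart.\<close>
proof (cases "n = 0")
  case True
  then show ?thesis by (simp add: indep_vars_def indep_sets_def)
next
  case False
  have pos: "0 \<le> \<tau> i" if "i \<le> n" for i
    using t that by (rule partition_nonneg)
  let ?D = "\<lambda>i \<omega>. Q (\<tau> (Suc i)) \<omega> - Q (\<tau> i) \<omega>"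
  let ?R = "{a \<times> b | a b. a \<in> sets borel \<and> b \<in> sets borel} :: (real \<times> real) set set"
  show ?thesis
  proof (subst indep_vars_finite[where E = "\<lambda>_. ?R"])
    have "0 \<in> {..<n}" using False by simp
    then show "{..<n} \<noteq> {}" by blast
    show "sets borel = sigma_sets (space borel) ?R" by (simp add: sets_borel_prod_generator)
    show "?D i \<in> borel_measurable M" if "i \<in> {..<n}" for i
      using that by (intro borel_measurable_diff Q_measurable pos) auto
    show "Int_stable ?R" by (rule Int_stable_pair_measure_generator)
    show "space borel \<in> ?R" by (auto intro!: exI[of _ UNIV])
    show "\<forall>A\<in>{..<n} \<rightarrow> ?R. prob (\<Inter>j\<in>{..<n}. ?D j -` A j \<inter> space M) = (\<Prod>j\<in>{..<n}. prob (?D j -` A j \<inter> space M))"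
    proof
      fix A assume A: "A \<in> {..<n} \<rightarrow> ?R"
      \<comment> \<open>Beyond n the rectangle is taken empty, so that the sides are Borel for every
        index.\<close>
      have "\<exists>p. fst p \<in> sets borel \<and> snd p \<in> sets borel \<and> (i < n \<longrightarrow> A i = fst p \<times> snd p)" for i
      proof (cases "i < n")
        case True
        then have "A i \<in> ?R" using A by auto
        then show ?thesis by force
      qed (auto intro!: exI[of _ "({}, {})"])
      then obtain p where p: "\<And>i. fst (p i) \<in> sets borel" "\<And>i. snd (p i) \<in> sets borel"
          "\<And>i. i < n \<Longrightarrow> A i = fst (p i) \<times> snd (p i)" by metis
      have "complex_of_real (prob (\<Inter>j\<in>{..<n}. ?D j -` A j \<inter> space M)) =
        of_real (prob {\<omega> \<in> space M. \<forall>i<n. ?D i \<omega> \<in> fst (p i) \<times> snd (p i)})"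
        using False p(3) by (intro arg_cong[where f = "\<lambda>E. complex_of_real (prob E)"]) auto
      also have "\<dots> = (\<Prod>i<n. LINT \<omega>|M. G (ind (fst (p i))) (ind (snd (p i))) (S (\<tau> (Suc i) - \<tau> i) \<omega>))"
        by (rule prob_increments_rectangles[OF t p(1,2)])
      also have "\<dots> = (\<Prod>j<n. of_real (prob (?D j -` A j \<inter> space M)))"
      proof (rule prod.cong[OF refl])
        fix i assume i: "i \<in> {..<n}"
        have "?D i -` A i \<inter> space M = {\<omega> \<in> space M. ?D i \<omega> \<in> fst (p i) \<times> snd (p i)}"
          using p(3) i by auto
        then show "(LINT \<omega>|M. G (ind (fst (p i))) (ind (snd (p i))) (S (\<tau> (Suc i) - \<tau> i) \<omega>)) = of_real (prob (?D i -` A i \<inter> space M))"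
          using prob_increment_rectangle[of "\<tau> i" "\<tau> (Suc i) - \<tau> i", OF _ _ p(1,2)] pos[of i] t(2)[of i] i by simp
      qed
      finally show "prob (\<Inter>j\<in>{..<n}. ?D j -` A j \<inter> space M) = (\<Prod>j\<in>{..<n}. prob (?D j -` A j \<inter> space M))"
        unfolding of_real_prod[symmetric] of_real_eq_iff .
    qed
  qed auto
qed

text \<open>Rectangles generate the Borel sets and are closed under intersection, so it suffices to
  compare on them the increment from s with the one from 0, where Q vanishes.\<close>

lemma Q_stationary_increments:
  assumes s: "0 \<le> s" and h: "0 \<le> h"
  shows "distr M borel (\<lambda>\<omega>. Q (s + h) \<omega> - Q s \<omega>) = distr M borel (Q h)"
proof (rule measure_eqI_generator_eq[where \<Omega> = UNIV and A = "\<lambda>_. UNIV"])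
  let ?R = "{a \<times> b | a b. a \<in> sets borel \<and> b \<in> sets borel} :: (real \<times> real) set set"
  have m: "Q h \<in> borel_measurable M" "(\<lambda>\<omega>. Q (s + h) \<omega> - Q s \<omega>) \<in> borel_measurable M"
    using s h by (auto intro!: Q_measurable borel_measurable_diff)
  show "Int_stable ?R" by (rule Int_stable_pair_measure_generator)
  show "sets (distr M borel (\<lambda>\<omega>. Q (s + h) \<omega> - Q s \<omega>)) = sigma_sets UNIV ?R"
    "sets (distr M borel (Q h)) = sigma_sets UNIV ?R"
    by (simp_all add: sets_borel_prod_generator)
  show "range (\<lambda>_. UNIV) \<subseteq> ?R" by (auto intro!: exI[of _ UNIV])
  show "emeasure (distr M borel (\<lambda>\<omega>. Q (s + h) \<omega> - Q s \<omega>)) UNIV \<noteq> \<infinity>"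
    using m by (simp add: emeasure_distr emeasure_eq_measure)
  fix E assume "E \<in> ?R"
  then obtain a b where E: "E = a \<times> b" and ab: "a \<in> sets borel" "b \<in> sets borel" by auto
  have EB: "E \<in> sets borel" unfolding E by (rule borel_rectangle[OF ab])
  have "complex_of_real (prob {\<omega> \<in> space M. Q (s + h) \<omega> - Q s \<omega> \<in> E}) = of_real (prob {\<omega> \<in> space M. Q (0 + h) \<omega> - Q 0 \<omega> \<in> E})"
    unfolding E using prob_increment_rectangle[OF s h ab] prob_increment_rectangle[OF order_refl h ab] by simp
  also have "{\<omega> \<in> space M. Q (0 + h) \<omega> - Q 0 \<omega> \<in> E} = {\<omega> \<in> space M. Q h \<omega> \<in> E}"
    using Q_zero by auto
  finally have "prob ((\<lambda>\<omega>. Q (s + h) \<omega> - Q s \<omega>) -` E \<inter> space M) = prob (Q h -` E \<inter> space M)"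
    by (simp add: vimage_def Int_def conj_commute)
  then show "emeasure (distr M borel (\<lambda>\<omega>. Q (s + h) \<omega> - Q s \<omega>)) E = emeasure (distr M borel (Q h)) E"
    using m EB by (simp add: emeasure_distr emeasure_eq_measure)
qed auto

lemma Q_levy: "levy_process M Q"
proof -
  have right: "((\<lambda>s. Q s \<omega>) \<longlongrightarrow> Q t \<omega>) (at_right t)" if w: "\<omega> \<in> space M" and t: "0 \<le> t" for \<omega> t
  proof -
    have "((\<lambda>s. Z (S s \<omega>) \<omega>) \<longlongrightarrow> Z (S t \<omega>) \<omega>) (at_right t)" if "levy_process M Z" for Z :: "real \<Rightarrow> 'a \<Rightarrow> real"
      by (rule tendsto_compose_at_right[where f = "\<lambda>s. S s \<omega>" and x = "\<lambda>s. Z s \<omega>"])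
        (use that S_levy w t S_nonneg[OF w] S_mono[OF w] in \<open>auto simp: levy_process_def\<close>)
    from tendsto_Pair[OF this[OF X] this[OF Y]] show ?thesis unfolding Q_def .
  qed
  have left: "\<exists>l. ((\<lambda>s. Q s \<omega>) \<longlongrightarrow> l) (at_left t)" if w: "\<omega> \<in> space M" and t: "0 < t" for \<omega> t
  proof -
    obtain l where l: "((\<lambda>s. S s \<omega>) \<longlongrightarrow> l) (at_left t)" using S_levy w t unfolding levy_process_def by blast
    have "\<exists>m. ((\<lambda>s. Z (S s \<omega>) \<omega>) \<longlongrightarrow> m) (at_left t)" if "levy_process M Z" for Z :: "real \<Rightarrow> 'a \<Rightarrow> real"
      by (rule left_limit_compose[where f = "\<lambda>s. S s \<omega>" and x = "\<lambda>s. Z s \<omega>", OF l _ t])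
        (use that S_levy w S_mono[OF w] in \<open>auto simp: levy_process_def\<close>)
    from this[OF X] this[OF Y] obtain x y where "((\<lambda>s. X (S s \<omega>) \<omega>) \<longlongrightarrow> x) (at_left t)" "((\<lambda>s. Y (S s \<omega>) \<omega>) \<longlongrightarrow> y) (at_left t)"
      by blast
    from tendsto_Pair[OF this] show ?thesis
      unfolding Q_def by (rule exI)
  qed
  show ?thesis
    unfolding levy_process_def
    using prob_space_axioms Q_measurable Q_zero Q_indep_increments Q_stationary_increments right left
    by (intro conjI) blast+
qed

text \<open>The product formula for the single increment from 0 to t, since the exponential of an
  inner product factors over the coordinates.\<close>

lemma Q_char:
  assumes t: "0 \<le> t"
  shows "(LINT \<omega>|M. iexp (u \<bullet> Q t \<omega>)) =
    (LINT \<omega>|M. (LINT \<omega>'|M. iexp (fst u * X (S t \<omega>) \<omega>')) * (LINT \<omega>'|M. iexp (snd u * Y (S t \<omega>) \<omega>')))"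
proof -
  have "(LINT \<omega>|M. iexp (u \<bullet> Q t \<omega>)) = (LINT \<omega>|M. (\<Prod>i<1::nat. iexp (fst u * fst (Q (real (Suc i) * t) \<omega> - Q (real i * t) \<omega>))
     * iexp (snd u * snd (Q (real (Suc i) * t) \<omega> - Q (real i * t) \<omega>))))"
    by (intro Bochner_Integration.integral_cong refl)
      (simp add: Q_zero inner_prod_def distrib_left exp_add)
  also have "\<dots> = (LINT \<omega>|M. G (\<lambda>x. iexp (fst u * x)) (\<lambda>x. iexp (snd u * x)) (S t \<omega>))"
    using subordinated_increments_expectation[of "\<lambda>i. real i * t" 1 "\<lambda>_ x. iexp (fst u * x)" "\<lambda>_ x. iexp (snd u * x)"] t
    by simp
  also have "\<dots> = (LINT \<omega>|M. (LINT \<omega>'|M. iexp (fst u * X (S t \<omega>) \<omega>')) * (LINT \<omega>'|M. iexp (snd u * Y (S t \<omega>) \<omega>')))"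
    using t by (intro Bochner_Integration.integral_cong refl) (simp add: G_eq S_nonneg)
  finally show ?thesis .
qed

end

section \<open>The Levy measure\<close>

definition lattice_point :: "nat \<times> nat \<Rightarrow> real \<times> real" where
  "lattice_point k = (real (fst k), real (snd k))"

text \<open>An image of weighted counting measure, so that integrals become sums over pairs and the
  origin is left out from the start. The parameter c stands for \<theta> + lam1 + lam2; the context
  below states \<theta> > 0 as \<open>l1 + l2 < c\<close>.\<close>

definition tsfpp_levy :: "real \<Rightarrow> real \<Rightarrow> real \<Rightarrow> real \<Rightarrow> (real \<times> real) measure" where
  "tsfpp_levy a c l1 l2 =
     distr (density (count_space {k. k \<noteq> (0, 0)}) (\<lambda>k. ennreal (levy_mass a c l1 l2 k))) borel lattice_point"

context
  fixes a c l1 l2 :: real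
  assumes a: "0 < a" "a < 1" and l: "0 < l1" "0 < l2" and c: "l1 + l2 < c"
begin

lemma mass_nonneg: "k \<noteq> (0, 0) \<Longrightarrow> 0 \<le> levy_mass a c l1 l2 k"
  using levy_mass_nonneg[OF a] l by simp

lemma mass_summable: "levy_mass a c l1 l2 summable_on {k. k \<noteq> (0, 0)}"
  using levy_mass_has_sum(2)[OF a l c, of 1 1] by simp

lemma emeasure_tsfpp_levy:
  assumes B: "B \<in> sets borel"
  shows "emeasure (tsfpp_levy a c l1 l2) B =
    (\<Sum>\<^sub>\<infinity>k\<in>{k. k \<noteq> (0, 0)}. ennreal (levy_mass a c l1 l2 k) * emeasure (return borel (lattice_point k)) B)"
proof -
  have "emeasure (tsfpp_levy a c l1 l2) B = (\<integral>\<^sup>+ k. ennreal (levy_mass a c l1 l2 k) *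
      indicator (lattice_point -` B \<inter> {k. k \<noteq> (0, 0)}) k \<partial>count_space {k. k \<noteq> (0, 0)})"
    unfolding tsfpp_levy_def using B by (subst emeasure_distr) (auto simp: emeasure_density)
  also have "\<dots> = (\<integral>\<^sup>+ k. ennreal (levy_mass a c l1 l2 k * indicator B (lattice_point k)) \<partial>count_space {k. k \<noteq> (0, 0)})"
    by (intro nn_integral_cong) (auto simp: indicator_def)
  also have "\<dots> = (\<Sum>\<^sub>\<infinity>k\<in>{k. k \<noteq> (0, 0)}. ennreal (levy_mass a c l1 l2 k * indicator B (lattice_point k)))"
  proof (rule nn_integral_count_space_ennreal_infsum)
    show "(\<lambda>k. levy_mass a c l1 l2 k * indicator B (lattice_point k)) summable_on {k. k \<noteq> (0, 0)}"
      by (rule summable_on_comparison_test[OF mass_summable]) (auto simp: indicator_def mass_nonneg)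
  qed (auto simp: mass_nonneg)
  also have "\<dots> = (\<Sum>\<^sub>\<infinity>k\<in>{k. k \<noteq> (0, 0)}. ennreal (levy_mass a c l1 l2 k) * emeasure (return borel (lattice_point k)) B)"
    using B by (intro infsum_cong) (auto simp: indicator_def)
  finally show ?thesis .
qed

text \<open>The total mass is the double series at x = y = 1, that is c powr a - (c - (l1 + l2))
  powr a.\<close>

lemma finite_measure_tsfpp_levy: "finite_measure (tsfpp_levy a c l1 l2)"
proof
  have "emeasure (tsfpp_levy a c l1 l2) (space (tsfpp_levy a c l1 l2)) =
     (\<Sum>\<^sub>\<infinity>k\<in>{k. k \<noteq> (0, 0)}. ennreal (levy_mass a c l1 l2 k))"
    using emeasure_tsfpp_levy[of UNIV] by (simp add: tsfpp_levy_def)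
  also have "\<dots> = (\<integral>\<^sup>+ k. ennreal (levy_mass a c l1 l2 k) \<partial>count_space {k. k \<noteq> (0, 0)})"
    by (rule nn_integral_count_space_ennreal_infsum[symmetric, OF mass_summable]) (simp add: mass_nonneg)
  also have "\<dots> = ennreal (LINT k|count_space {k. k \<noteq> (0, 0)}. levy_mass a c l1 l2 k)"
    using has_sum_integral_count_space(1)[OF has_sum_infsum[OF mass_summable]
        summable_on_iff_abs_summable_on_real[THEN iffD1, OF mass_summable]] mass_nonneg
    by (intro nn_integral_eq_integral) (auto simp: AE_count_space)
  finally show "emeasure (tsfpp_levy a c l1 l2) (space (tsfpp_levy a c l1 l2)) \<noteq> \<infinity>" by simp
qed

text \<open>The double series at the two exponentials minus the one at (1, 1): the copies of c powr
  a cancel.\<close>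

lemma integral_tsfpp_levy_iexp:
  "(LINT x|tsfpp_levy a c l1 l2. iexp (u \<bullet> x) - 1) =
     of_real ((c - (l1 + l2)) powr a) -
     (of_real (c - (l1 + l2)) + (of_real l1 * (1 - iexp (fst u)) + of_real l2 * (1 - iexp (snd u)))) powr of_real a"
proof -
  let ?A = "{k. k \<noteq> (0::nat, 0::nat)}" and ?m = "levy_mass a c l1 l2"
  let ?x = "iexp (fst u)" and ?y = "iexp (snd u)"
  have iexp: "iexp (u \<bullet> lattice_point (j, k)) = ?x ^ j * ?y ^ k" for j k
    by (simp add: lattice_point_def inner_prod_def exp_of_nat_mult[symmetric] exp_add[symmetric] algebra_simps)
  have sum: "((\<lambda>k. ?m k *\<^sub>R (iexp (u \<bullet> lattice_point k) - 1)) has_sum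
      ((of_real (c powr a) - (of_real c - (of_real l1 * ?x + of_real l2 * ?y)) powr of_real a) -
       (of_real (c powr a) - (of_real c - (of_real l1 * 1 + of_real l2 * 1)) powr of_real a))) ?A"
  proof -
    note h = levy_mass_has_sum(1)[OF a l c]
    have "((\<lambda>k. (case k of (i, j) \<Rightarrow> of_real (?m (i, j)) * (?x ^ i * ?y ^ j)) + (-1) * (case k of (i, j) \<Rightarrow> of_real (?m (i, j)) * (1 ^ i * 1 ^ j))) has_sum
      ((of_real (c powr a) - (of_real c - (of_real l1 * ?x + of_real l2 * ?y)) powr of_real a) +
       (-1) * (of_real (c powr a) - (of_real c - (of_real l1 * 1 + of_real l2 * 1)) powr of_real a))) ?A"
      by (rule has_sum_add[OF h has_sum_cmult_right[OF h]]) simp_all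
    moreover have "(case k of (i, j) \<Rightarrow> of_real (?m (i, j)) * (?x ^ i * ?y ^ j)) + (-1) * (case k of (i, j) \<Rightarrow> of_real (?m (i, j)) * (1 ^ i * 1 ^ j)) =
      ?m k *\<^sub>R (iexp (u \<bullet> lattice_point k) - 1)" for k
    proof (cases k)
      case (Pair i j)
      then show ?thesis unfolding Pair iexp by (simp add: scaleR_conv_of_real right_diff_distrib)
    qed
    ultimately show ?thesis by (simp only: mult_minus1 diff_conv_add_uminus)
  qed
  have norm: "(\<lambda>k. norm (?m k *\<^sub>R (iexp (u \<bullet> lattice_point k) - 1))) summable_on ?A"
  proof (rule summable_on_comparison_test)
    show "(\<lambda>k. ?m k * 2) summable_on ?A" by (rule summable_on_cmult_left[OF mass_summable])
    fix k assume "k \<in> ?A"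
    moreover have "norm (iexp (u \<bullet> lattice_point k) - 1) \<le> 2"
      using norm_triangle_ineq4[of "iexp (u \<bullet> lattice_point k)" 1] by simp
    ultimately show "norm (?m k *\<^sub>R (iexp (u \<bullet> lattice_point k) - 1)) \<le> ?m k * 2"
      using mass_nonneg[of k] by (auto intro!: mult_left_mono)
  qed simp
  have "(LINT x|tsfpp_levy a c l1 l2. iexp (u \<bullet> x) - 1) =
     (LINT k|density (count_space ?A) (\<lambda>k. ennreal (?m k)). iexp (u \<bullet> lattice_point k) - 1)"
    unfolding tsfpp_levy_def by (subst integral_distr) auto
  also have "\<dots> = (LINT k|count_space ?A. ?m k *\<^sub>R (iexp (u \<bullet> lattice_point k) - 1))"
    by (subst integral_density) (auto simp: AE_count_space mass_nonneg)
  also have "\<dots> = (of_real (c powr a) - (of_real c - (of_real l1 * ?x + of_real l2 * ?y)) powr of_real a) -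
       (of_real (c powr a) - (of_real c - (of_real l1 * 1 + of_real l2 * 1)) powr of_real a)"
    by (rule has_sum_integral_count_space(2)[OF sum norm])
  also have "(of_real c - (of_real l1 * 1 + of_real l2 * 1)) powr of_real a = complex_of_real ((c - (l1 + l2)) powr a)"
    using c by (simp add: powr_of_real flip: of_real_add of_real_diff)
  finally show ?thesis by (simp add: algebra_simps)
qed

end

theorem theorem3p3:
  fixes M :: "'a measure"
    and S :: "real \<Rightarrow> 'a \<Rightarrow> real"
    and N1 N2 :: "real \<Rightarrow> 'a \<Rightarrow> nat"
    and \<alpha> \<theta> lam1 lam2 :: real
  assumes "0 < \<alpha>" and "\<alpha> < 1" and "0 < \<theta>" and "0 < lam1" and "0 < lam2"
    and "tempered_stable_subordinator M \<alpha> \<theta> S"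
    and "poisson_process M lam1 N1"
    and "poisson_process M lam2 N2"
    and "independent_processes M
           (\<lambda>i. [S, \<lambda>t \<omega>. real (N1 t \<omega>), \<lambda>t \<omega>. real (N2 t \<omega>)] ! i) {..<3}"
  shows "\<exists>V. has_levy_measure M (bivariate_tsfpp S N1 N2) V \<and>
    (\<forall>B\<in>sets borel. emeasure V B =
      (\<Sum>\<^sub>\<infinity>(k1, k2)\<in>{k :: nat \<times> nat. k \<noteq> (0, 0)}.
         ennreal (lam1 ^ k1 * lam2 ^ k2 / (fact k1 * fact k2)
           * (\<alpha> * Gamma (real k1 + real k2 - \<alpha>) / Gamma (1 - \<alpha>))
           * (\<theta> + lam1 + lam2) powr (\<alpha> - real k1 - real k2))
         * emeasure (return borel (real k1, real k2)) B))"
proof -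
  note a = \<open>0 < \<alpha>\<close> \<open>\<alpha> < 1\<close> and l = \<open>0 < lam1\<close> \<open>0 < lam2\<close>
  define c where "c = \<theta> + lam1 + lam2"
  have c: "lam1 + lam2 < c" "c - (lam1 + lam2) = \<theta>" using \<open>0 < \<theta>\<close> by (simp_all add: c_def)
  define V where "V = tsfpp_levy \<alpha> c lam1 lam2"
  have sub: "subordinator M S"
    and laplace: "\<And>t u. 0 \<le> t \<Longrightarrow> 0 \<le> u \<Longrightarrow> (LINT \<omega>|M. exp (- u * S t \<omega>)) = exp (- t * ((u + \<theta>) powr \<alpha> - \<theta> powr \<alpha>))"
    using assms(6) by (auto simp: tempered_stable_subordinator_def)
  interpret prob_space M using sub by (simp add: subordinator_def levy_process_def)
  interpret subordinated_pair M S "\<lambda>t \<omega>. real (N1 t \<omega>)" "\<lambda>t \<omega>. real (N2 t \<omega>)"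
    using sub assms(7,8,9) by unfold_locales (auto simp: poisson_process_def independent_processes_def)
  have Q: "bivariate_tsfpp S N1 N2 = Q"
    by (simp add: fun_eq_iff bivariate_tsfpp_def Q_def)
  have char: "(LINT \<omega>|M. iexp (u \<bullet> Q t \<omega>)) = exp (of_real t * (LINT x|V. iexp (u \<bullet> x) - 1))" if t: "0 \<le> t" for t u
  proof -
    let ?z = "of_real lam1 * (1 - iexp (fst u)) + of_real lam2 * (1 - iexp (snd u))"
    \<comment> \<open>The exponential is the N-th power of \<open>iexp v\<close>, a point of modulus
      1, so the Poisson generating function applies.\<close>
    have p: "(LINT \<omega>'|M. iexp (v * real (N s \<omega>'))) = exp (of_real (lam * s) * (iexp v - 1))"
      if "poisson_process M lam N" "0 < lam" "0 \<le> s" for N lam v s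
      using poisson_process_char[OF that, of "iexp v"]
      by (simp add: exp_of_nat_mult[symmetric] mult_ac)
    have "(LINT \<omega>|M. iexp (u \<bullet> Q t \<omega>)) = (LINT \<omega>|M. exp (- ?z * of_real (S t \<omega>)))"
      unfolding Q_char[OF t]
    proof (rule Bochner_Integration.integral_cong[OF refl])
      fix \<omega> assume "\<omega> \<in> space M"
      then have s: "0 \<le> S t \<omega>" using t by (rule S_nonneg)
      show "(LINT \<omega>'|M. iexp (fst u * real (N1 (S t \<omega>) \<omega>'))) * (LINT \<omega>'|M. iexp (snd u * real (N2 (S t \<omega>) \<omega>'))) =
          exp (- ?z * of_real (S t \<omega>))"
        unfolding p[OF assms(7) l(1) s] p[OF assms(8) l(2) s] by (simp add: exp_add[symmetric] algebra_simps)
    qed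
    also have "\<dots> = exp (- of_real t * ((?z + of_real \<theta>) powr of_real \<alpha> - of_real (\<theta> powr \<alpha>)))"
      by (rule tempered_stable_laplace_complex[OF S_measurable[OF t] S_nonneg[OF _ t] laplace[OF t] \<open>0 < \<theta>\<close> poisson_exponent_half_plane[OF l]])
    also have "\<dots> = exp (of_real t * (LINT x|V. iexp (u \<bullet> x) - 1))"
      unfolding V_def integral_tsfpp_levy_iexp[OF a l c(1)] c(2) by (simp add: algebra_simps)
    finally show ?thesis .
  qed
  interpret V: finite_measure V
    unfolding V_def by (rule finite_measure_tsfpp_levy[OF a l c(1)])
  have sV[measurable_cong]: "sets V = sets borel" by (simp add: V_def tsfpp_levy_def)
  \<comment> \<open>As V is finite, the exponent is already the integral of
    \<open>iexp (u \<bullet> x) - 1\<close>. The drift b only compensates the truncation term, so it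
    is the integral of x over the unit ball.\<close>
  define b where "b = (LINT x|V. indicat_real (cball 0 1) x *\<^sub>R x)"
  have bi: "integrable V (\<lambda>x. indicat_real (cball 0 1) x *\<^sub>R x)"
    by (rule V.integrable_const_bound[of _ 1]) (auto simp: indicator_def)
  have "has_levy_measure M Q V"
    unfolding has_levy_measure_def
  proof (intro conjI exI[of _ b] exI[of _ "\<lambda>_. 0"] allI impI)
    show "levy_process M Q" by (rule Q_levy)
    show "sets V = sets borel" by (rule sV)
    have "lattice_point k \<noteq> 0" if "k \<noteq> (0, 0)" for k
      using that by (cases k) (auto simp: lattice_point_def zero_prod_def)
    then have z: "emeasure (return borel (lattice_point k)) {0} = 0" if "k \<noteq> (0, 0)" for k
      using that by (simp add: indicator_def)
    show "emeasure V {0} = 0"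
      unfolding V_def
    proof (subst emeasure_tsfpp_levy[OF a l c(1)])
      show "(\<Sum>\<^sub>\<infinity>k\<in>{k. k \<noteq> (0, 0)}. ennreal (levy_mass \<alpha> c lam1 lam2 k) * emeasure (return borel (lattice_point k)) {0}) = 0"
        by (rule infsum_0) (metis (mono_tags, lifting) mem_Collect_eq mult_zero_right z)
    qed simp
    have "ennreal (min 1 r) \<le> 1" for r
      using ennreal_leI[OF min.cobounded1[of 1 r]] by simp
    then have "(\<integral>\<^sup>+ x. ennreal (min 1 ((norm x)\<^sup>2)) \<partial>V) \<le> (\<integral>\<^sup>+ x. 1 \<partial>V)"
      by (intro nn_integral_mono)
    also have "(\<integral>\<^sup>+ x. 1 \<partial>V) = emeasure V (space V)"
      by simp
    also have "\<dots> < \<infinity>"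
      using V.emeasure_finite[of "space V"] unfolding infinity_ennreal_def less_top .
    finally show "(\<integral>\<^sup>+ x. ennreal (min 1 ((norm x)\<^sup>2)) \<partial>V) < \<infinity>" .
    fix t :: real and u assume t: "0 \<le> t"
    have e: "integrable V (\<lambda>x. iexp (u \<bullet> x) - 1)"
    proof (rule V.integrable_const_bound[of _ 2])
      show "AE x in V. norm (iexp (u \<bullet> x) - 1) \<le> 2"
        by (rule AE_I2, rule order_trans[OF norm_triangle_ineq4]) simp
    qed measurable
    have bu: "(LINT x|V. \<i> * of_real ((u \<bullet> x) * indicat_real (cball 0 1) x)) = \<i> * of_real (b \<bullet> u)"
      "integrable V (\<lambda>x. \<i> * complex_of_real ((u \<bullet> x) * indicat_real (cball 0 1) x))"
    proof -
      have "integrable V (\<lambda>x. (indicat_real (cball 0 1) x *\<^sub>R x) \<bullet> u)"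
        using bi by (rule integrable_inner_left[rotated])
      moreover have "(LINT x|V. (indicat_real (cball 0 1) x *\<^sub>R x) \<bullet> u) = b \<bullet> u"
        unfolding b_def using bi by (intro integral_inner_left) auto
      moreover have "(\<lambda>x. (indicat_real (cball 0 1) x *\<^sub>R x) \<bullet> u) = (\<lambda>x. (u \<bullet> x) * indicat_real (cball 0 1) x)"
        by (simp add: fun_eq_iff inner_commute)
      ultimately have "integrable V (\<lambda>x. (u \<bullet> x) * indicat_real (cball 0 1) x)" "(LINT x|V. (u \<bullet> x) * indicat_real (cball 0 1) x) = b \<bullet> u"
        by simp_all
      then show "(LINT x|V. \<i> * of_real ((u \<bullet> x) * indicat_real (cball 0 1) x)) = \<i> * of_real (b \<bullet> u)"
        "integrable V (\<lambda>x. \<i> * complex_of_real ((u \<bullet> x) * indicat_real (cball 0 1) x))"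
        by (simp_all del: of_real_mult)
    qed
    have "(LINT x|V. iexp (u \<bullet> x) - 1 - \<i> * of_real ((u \<bullet> x) * indicat_real (cball 0 1) x)) =
        (LINT x|V. iexp (u \<bullet> x) - 1) - \<i> * of_real (b \<bullet> u)"
      using e bu by (subst Bochner_Integration.integral_diff) auto
    then show "(LINT \<omega>|M. iexp (u \<bullet> Q t \<omega>)) = exp (of_real t * (\<i> * of_real (b \<bullet> u) - of_real (u \<bullet> 0) / 2 +
        (LINT x|V. iexp (u \<bullet> x) - 1 - \<i> * of_real ((u \<bullet> x) * indicat_real (cball 0 1) x))))"
      unfolding char[OF t] by simp
  qed (auto intro: linear_zero)
  moreover have "emeasure V B = (\<Sum>\<^sub>\<infinity>(k1, k2)\<in>{k :: nat \<times> nat. k \<noteq> (0, 0)}.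
         ennreal (lam1 ^ k1 * lam2 ^ k2 / (fact k1 * fact k2)
           * (\<alpha> * Gamma (real k1 + real k2 - \<alpha>) / Gamma (1 - \<alpha>))
           * (\<theta> + lam1 + lam2) powr (\<alpha> - real k1 - real k2))
         * emeasure (return borel (real k1, real k2)) B)" if "B \<in> sets borel" for B
    unfolding V_def emeasure_tsfpp_levy[OF a l c(1) that]
    by (intro infsum_cong) (auto simp: levy_mass_def levy_coeff_def lattice_point_def c_def algebra_simps)
  ultimately show ?thesis unfolding Q by blast
qed

end
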